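(* Let $p$ be a prime, $R=\mathbb{F}_p[X,Y,Z,W]/(X^4+Y^4+Z^4+W^4)$, $I=(x,y,z)$ and $\mathfrak{m}=(I,w)$, where lower-case letters denote images of the variables. Then $I^*=\mathfrak{m}$ if $p=2$; $I^*=I+\mathfrak{m}^2$ if $p=3$; and $I^*=I+\mathfrak{m}^3$ if $p\geq5$.
   Context: $J^*$ denotes the tight closure: $x\in J^*$ iff there is $c$ not in any minimal prime of $R$ with $cx^q\in J^{[q]}$ for all large $q=p^e$, where $J^{[q]}$ is generated by $q$-th powers of generators of $J$. *)

theory Defs
  imports "HOL-Library.Poly_Mapping" "HOL-Algebra.QuotRing" "HOL-Algebra.Ideal_Product"
    "Berlekamp_Zassenhaus.Finite_Field"
begin

datatype var = VX | VY | VZ | VW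

text \<open>Polynomials in the variables X,Y,Z,W with coefficients in 'a:
  finitely supported functions from monomials (exponent vectors) to coefficients.\<close>
type_synonym 'a poly4 = "(var \<Rightarrow>\<^sub>0 nat) \<Rightarrow>\<^sub>0 'a"

definition Var :: "var \<Rightarrow> 'a::comm_ring_1 poly4" where
  "Var v = Poly_Mapping.single (Poly_Mapping.single v 1) 1"

text \<open>The polynomial ring F_p[X,Y,Z,W] as an HOL-Algebra ring (F_p = 'p mod_ring, p = CARD('p)).\<close>
definition Sring :: "('p::prime_card mod_ring) poly4 ring" where
  "Sring = \<lparr>carrier = UNIV, monoid.mult = (*), one = 1, ring.zero = 0, ring.add = (+)\<rparr>"

definition fpoly :: "('p::prime_card mod_ring) poly4" where
  "fpoly = Var VX ^ 4 + Var VY ^ 4 + Var VZ ^ 4 + Var VW ^ 4"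

definition Rring :: "('p::prime_card mod_ring) poly4 set ring" where
  "Rring = Sring Quot (genideal Sring {fpoly})"

definition rvar :: "var \<Rightarrow> ('p::prime_card mod_ring) poly4 set" where
  "rvar v = genideal Sring {fpoly} +>\<^bsub>Sring\<^esub> Var v"

primrec ideal_power :: "('a, 'b) ring_scheme \<Rightarrow> 'a set \<Rightarrow> nat \<Rightarrow> 'a set" where
  "ideal_power R I 0 = carrier R"
| "ideal_power R I (Suc n) = ideal_prod R I (ideal_power R I n)"

definition minimal_prime :: "('a, 'b) ring_scheme \<Rightarrow> 'a set \<Rightarrow> bool" where
  "minimal_prime R P \<longleftrightarrow> primeideal P R \<and> (\<forall>Q. primeideal Q R \<and> Q \<subseteq> P \<longrightarrow> Q = P)"

text \<open>Frobenius power J^[q] of the ideal generated by G.\<close>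
definition frobenius_power :: "('a, 'b) ring_scheme \<Rightarrow> 'a set \<Rightarrow> nat \<Rightarrow> 'a set" where
  "frobenius_power R G q = genideal R ((\<lambda>g. g [^]\<^bsub>R\<^esub> q) ` G)"

definition tight_closure :: "('a, 'b) ring_scheme \<Rightarrow> nat \<Rightarrow> 'a set \<Rightarrow> 'a set" where
  "tight_closure R p G = {x \<in> carrier R. \<exists>c \<in> carrier R. (\<forall>P. minimal_prime R P \<longrightarrow> c \<notin> P) \<and>
      (\<exists>e0. \<forall>e \<ge> e0. c \<otimes>\<^bsub>R\<^esub> x [^]\<^bsub>R\<^esub> (p ^ e) \<in> frobenius_power R G (p ^ e))}"

lemma cring_Sring: "cring Sring"
  unfolding Sring_def
  by (rule cringI; (rule abelian_groupI | rule comm_monoidI)?)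
     (auto simp: algebra_simps intro: exI[of _ "- _"] Units_def)

end

theory Submission
  imports Defs "HOL-Algebra.Ring_Divisibility"
begin

text \<open>Write \<open>g = X^4 + Y^4 + Z^4\<close>, so that R is free over k[X,Y,Z] with basis 1, w, w^2, w^3 and
  w^4 = -g. Since R/I = k[w]/(w^4), the tight closure of I is I + (w^k) = I + m^k for some k, and it
  suffices to locate the least k with w^k in it. Powers w^(kq) reduce to powers of g, and
  membership in the Frobenius power of I becomes membership in the monomial ideal
  (X^q, Y^q, Z^q) of k[X,Y,Z].

  For p = 2, 3 the power w^(kq) is divisible by a p-power of g that already lies in the monomial ideal.
  For larger p, X g^b with b = 3q div 4 is there because its degree exceeds that of the
  socle monomial (XYZ)^(q-1).

  Conversely, suppose c g^N lies in the monomial ideal for all large q with N about (k-1)q/4. Writing N in base p,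
  a factor (X^n + Y^n + Z^n)^u with n = 4 p^i splits off from g^N, and the remaining cofactor has
  degree below n; so each monomial of the factor with nonzero coefficient may be tested separately. A
  balanced monomial then has all exponents too small. For p congruent to 3 mod 4 one base-p digit
  provides such a monomial; for p congruent to 1 mod 4 two digits are needed.\<close>

hide_const (open) Divisibility.prime

section \<open>Supports of polynomials and degrees\<close>

text \<open>An order on the variables is only needed for polynomials to form an integral domain.\<close>

instantiation var :: linorder
begin

definition var_index :: "var \<Rightarrow> nat" where
  "var_index v = (case v of VX \<Rightarrow> 0 | VY \<Rightarrow> 1 | VZ \<Rightarrow> 2 | VW \<Rightarrow> 3)"

definition less_eq_var :: "var \<Rightarrow> var \<Rightarrow> bool" where
  "u \<le> v \<longleftrightarrow> var_index u \<le> var_index v"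

definition less_var :: "var \<Rightarrow> var \<Rightarrow> bool" where
  "u < v \<longleftrightarrow> var_index u < var_index v"

instance
  by standard
    (auto simp: less_eq_var_def less_var_def var_index_def split: var.splits)

end

abbreviation keys where "keys \<equiv> Poly_Mapping.keys"
abbreviation lookup where "lookup \<equiv> Poly_Mapping.lookup"

lemma poly_mapping_eq_sum_single:
  "f = (\<Sum>k\<in>keys f. Poly_Mapping.single k (lookup f k))"
  by (rule poly_mapping_eqI)
    (auto simp: lookup_sum lookup_single when_def sum.delta' in_keys_iff)

lemma keys_sum_disjoint:
  assumes "finite I" and "i \<in> I"
    and "\<And>j k. \<lbrakk>j \<in> I; j \<noteq> i; k \<in> keys (f i)\<rbrakk> \<Longrightarrow> k \<notin> keys (f j)"
  shows "keys (f i) \<subseteq> keys (\<Sum>j\<in>I. f j)"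
proof
  fix k assume k: "k \<in> keys (f i)"
  have "lookup (\<Sum>j\<in>I. f j) k = lookup (f i) k + (\<Sum>j\<in>I - {i}. lookup (f j) k)"
    unfolding lookup_sum by (rule sum.remove) (use assms in auto)
  moreover have "(\<Sum>j\<in>I - {i}. lookup (f j) k) = 0"
    using assms(3) k by (intro sum.neutral) (auto simp: in_keys_iff)
  ultimately show "k \<in> keys (\<Sum>j\<in>I. f j)"
    using k by (simp add: in_keys_iff)
qed

lemma keys_add_disjoint:
  assumes "keys f \<inter> keys g = {}"
  shows "keys f \<subseteq> keys (f + g)"
  using assms by (auto simp: in_keys_iff lookup_add disjoint_iff)

lemma poly_mapping_split:
  fixes f :: "'a \<Rightarrow>\<^sub>0 'b::comm_monoid_add"
  obtains g h where "f = g + h" "keys g \<subseteq> {k. P k}" "keys h \<subseteq> {k. \<not> P k}"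
proof
  let ?m = "\<lambda>k. Poly_Mapping.single k (lookup f k)"
  have "f = (\<Sum>k\<in>keys f. ?m k)" by (rule poly_mapping_eq_sum_single)
  also have "\<dots> = (\<Sum>k\<in>keys f \<inter> {k. P k}. ?m k) + (\<Sum>k\<in>keys f - {k. P k}. ?m k)"
    by (rule sum.Int_Diff) simp
  finally show "f = (\<Sum>k\<in>keys f \<inter> {k. P k}. ?m k) + (\<Sum>k\<in>keys f - {k. P k}. ?m k)" .
  show "keys (\<Sum>k\<in>keys f \<inter> {k. P k}. ?m k) \<subseteq> {k. P k}"
    by (rule order.trans[OF keys_sum]) (auto split: if_splits)
  show "keys (\<Sum>k\<in>keys f - {k. P k}. ?m k) \<subseteq> {k. \<not> P k}"
    by (rule order.trans[OF keys_sum]) (auto split: if_splits)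
qed

lemma keys_uminus: "keys (- f) = keys f"
  by (auto simp: in_keys_iff)

lemma keys_diff_subset: "keys (f - g) \<subseteq> keys f \<union> keys g"
  by (auto simp: in_keys_iff lookup_minus)

text \<open>Such sets are the exponent sets of monomial ideals; \<open>keys f \<subseteq> U\<close>
  then says that f lies in the ideal.\<close>

definition up_closed :: "'a::monoid_add set \<Rightarrow> bool" where
  "up_closed U \<longleftrightarrow> (\<forall>k\<in>U. \<forall>l. k + l \<in> U)"

lemma keys_mult_up_closed:
  fixes f g :: "'a::comm_monoid_add \<Rightarrow>\<^sub>0 'b::comm_semiring_1"
  assumes "up_closed U" and "keys f \<subseteq> U"
  shows "keys (f * g) \<subseteq> U"
  using keys_mult[of f g] assms by (fastforce simp: up_closed_def)

text \<open>Bounds replace a degree function, so the zero polynomial needs no convention. The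
  parameter \<open>\<phi>\<close> covers both the exponent of one variable and the total degree in
  X, Y, Z.\<close>

definition deg_le :: "('k \<Rightarrow> nat) \<Rightarrow> nat \<Rightarrow> ('k \<Rightarrow>\<^sub>0 'a::zero) \<Rightarrow> bool" where
  "deg_le \<phi> n f \<longleftrightarrow> (\<forall>k\<in>keys f. \<phi> k \<le> n)"

definition deg_ge :: "('k \<Rightarrow> nat) \<Rightarrow> nat \<Rightarrow> ('k \<Rightarrow>\<^sub>0 'a::zero) \<Rightarrow> bool" where
  "deg_ge \<phi> n f \<longleftrightarrow> (\<forall>k\<in>keys f. n \<le> \<phi> k)"

definition weight :: "('k::monoid_add \<Rightarrow> nat) \<Rightarrow> bool" where
  "weight \<phi> \<longleftrightarrow> \<phi> 0 = 0 \<and> (\<forall>k l. \<phi> (k + l) = \<phi> k + \<phi> l)"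

lemma deg_le_mono: "deg_le \<phi> m f \<Longrightarrow> m \<le> n \<Longrightarrow> deg_le \<phi> n f"
  by (auto simp: deg_le_def)

lemma deg_le_add: "deg_le \<phi> n f \<Longrightarrow> deg_le \<phi> n g \<Longrightarrow> deg_le \<phi> n (f + g)"
  using keys_add[of f g] by (auto simp: deg_le_def)

lemma deg_ge_add: "deg_ge \<phi> n f \<Longrightarrow> deg_ge \<phi> n g \<Longrightarrow> deg_ge \<phi> n (f + g)"
  using keys_add[of f g] by (auto simp: deg_ge_def)

lemma deg_le_uminus: "deg_le \<phi> n f \<Longrightarrow> deg_le \<phi> n (- f)"
  by (auto simp: deg_le_def keys_uminus)

lemma deg_le_mult:
  "weight \<phi> \<Longrightarrow> deg_le \<phi> m f \<Longrightarrow> deg_le \<phi> n g \<Longrightarrow> deg_le \<phi> (m + n) (f * g)"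
  using keys_mult[of f g] by (fastforce simp: deg_le_def weight_def intro: add_mono)

lemma deg_ge_mult:
  "weight \<phi> \<Longrightarrow> deg_ge \<phi> m f \<Longrightarrow> deg_ge \<phi> n g \<Longrightarrow> deg_ge \<phi> (m + n) (f * g)"
  using keys_mult[of f g] by (fastforce simp: deg_ge_def weight_def intro: add_mono)

lemma deg_le_one: "weight \<phi> \<Longrightarrow> deg_le \<phi> n 1"
  by (auto simp: deg_le_def weight_def)

lemma deg_le_power:
  fixes f :: "'k::comm_monoid_add \<Rightarrow>\<^sub>0 'a::comm_semiring_1"
  assumes "weight \<phi>" "deg_le \<phi> m f"
  shows "deg_le \<phi> (n * m) (f ^ n)"
  by (induction n) (use assms in \<open>auto intro: deg_le_mult deg_le_one\<close>)

lemma deg_ge_power: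
  fixes f :: "'k::comm_monoid_add \<Rightarrow>\<^sub>0 'a::comm_semiring_1"
  assumes "weight \<phi>" "deg_ge \<phi> m f"
  shows "deg_ge \<phi> (n * m) (f ^ n)"
proof (induction n)
  case (Suc n)
  show ?case using deg_ge_mult[OF assms Suc] by simp
qed (simp add: deg_ge_def)

lemma deg_le_exists: obtains n where "deg_le \<phi> n f"
proof
  \<comment> \<open>For f = 0 the maximum of the empty set is unspecified, but the bound is then
    vacuous.\<close>
  show "deg_le \<phi> (Max (\<phi> ` keys f)) f" by (simp add: deg_le_def)
qed

lemma deg_le_single: "\<phi> k \<le> n \<Longrightarrow> deg_le \<phi> n (Poly_Mapping.single k a)"
  by (simp add: deg_le_def)

section \<open>Exponents and degrees in the four variables\<close>

abbreviation expo :: "var \<Rightarrow> (var \<Rightarrow>\<^sub>0 nat) \<Rightarrow> nat" where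
  "expo v k \<equiv> lookup k v"

definition xyz_deg :: "(var \<Rightarrow>\<^sub>0 nat) \<Rightarrow> nat" where
  "xyz_deg k = lookup k VX + lookup k VY + lookup k VZ"

lemma weight_expo [simp]: "weight (expo v)"
  by (simp add: weight_def lookup_add)

lemma weight_xyz_deg [simp]: "weight xyz_deg"
  by (simp add: weight_def xyz_deg_def lookup_add)

lemma Var_power: "Var v ^ n = Poly_Mapping.single (Poly_Mapping.single v n) 1"
  by (induction n) (simp_all add: Var_def mult_single flip: single_add)

lemma Var_neq_0 [simp]: "Var v \<noteq> (0 :: 'a::comm_ring_1 poly4)"
  by (metis Var_def keys_single keys_zero insert_not_empty zero_neq_one)

lemma keys_Var_power [simp]: "keys (Var v ^ n :: 'a::comm_ring_1 poly4) = {Poly_Mapping.single v n}"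
  by (simp add: Var_power)

lemma deg_le_Var_power:
  "deg_le (expo v) n (Var v ^ n :: 'a::comm_ring_1 poly4)"
  "u \<noteq> v \<Longrightarrow> deg_le (expo v) 0 (Var u ^ n :: 'a::comm_ring_1 poly4)"
  by (simp_all add: deg_le_def lookup_single)

lemma poly4_monomial_decomp:
  fixes f :: "'a::comm_ring_1 poly4"
  assumes "\<And>f g. P f \<Longrightarrow> P g \<Longrightarrow> P (f + g)" "P 0" "\<And>k a. P (Poly_Mapping.single k a)"
  shows "P f"
proof -
  have "P (\<Sum>k\<in>A. Poly_Mapping.single k (lookup f k))" if "finite A" for A
    using that by (induction A rule: finite_induct) (use assms in auto)
  from this[of "keys f"] show ?thesis
    by (simp flip: poly_mapping_eq_sum_single)
qed

lemma deg_le_of_nat: "deg_le (expo v) 0 (of_nat n :: 'a::comm_ring_1 poly4)"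
  by (auto simp: deg_le_def in_keys_iff lookup_of_nat when_def split: if_splits)

lemma CHAR_poly4: "CHAR('a::comm_ring_1 poly4) = CHAR('a)"
proof -
  have "of_nat n = (0 :: 'a poly4) \<longleftrightarrow> of_nat n = (0 :: 'a)" for n
  proof
    assume "of_nat n = (0 :: 'a poly4)"
    hence "lookup (Poly_Mapping.single 0 (of_nat n :: 'a)) (0 :: var \<Rightarrow>\<^sub>0 nat) = 0" by simp
    thus "of_nat n = (0 :: 'a)" by (simp del: single_of_nat)
  next
    assume "of_nat n = (0 :: 'a)"
    hence "Poly_Mapping.single 0 (of_nat n :: 'a) = (0 :: 'a poly4)" by (simp del: single_of_nat)
    thus "of_nat n = (0 :: 'a poly4)" by simp
  qed
  thus ?thesis by (intro CHAR_eqI) (simp_all add: of_nat_eq_0_iff_char_dvd)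
qed

text \<open>The terms of the binomial expansion share no monomial: the exponent of v
  divided by n tells them apart.\<close>

lemma peel_binomial:
  fixes f B :: "'a::comm_ring_1 poly4"
  assumes U: "up_closed U"
    and f: "deg_le (expo v) r f" "r < n"
    and B: "deg_le (expo v) 0 B"
    and sub: "keys (f * (Var v ^ n + B) ^ u) \<subseteq> U"
    and i: "i \<le> u"
    and p: "prime CHAR('a)" "\<not> CHAR('a) dvd (u choose i)"
  shows "keys (f * Var v ^ (n * i) * B ^ (u - i)) \<subseteq> U"
proof -
  define t where "t k = Var v ^ (n * k) * (of_nat (u choose k) * (f * B ^ (u - k)))" for k
  have expand: "f * (Var v ^ n + B) ^ u = (\<Sum>k\<le>u. t k)"
    by (simp add: binomial_ring sum_distrib_left t_def mult_ac flip: power_mult)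
  have key: "expo v \<kappa> div n = k" if \<kappa>: "\<kappa> \<in> keys (t k)" for \<kappa> k
  proof -
    have "deg_le (expo v) (0 + (r + (u - k) * 0)) (of_nat (u choose k) * (f * B ^ (u - k)))"
      using f B by (intro deg_le_mult deg_le_power deg_le_of_nat) auto
    moreover obtain l where "\<kappa> = Poly_Mapping.single v (n * k) + l"
        "l \<in> keys (of_nat (u choose k) * (f * B ^ (u - k)))"
      using keys_mult[of "Var v ^ (n * k)" "of_nat (u choose k) * (f * B ^ (u - k))"] \<kappa>
      unfolding t_def by auto
    ultimately have "\<kappa> = Poly_Mapping.single v (n * k) + l" "expo v l \<le> r"
      by (auto simp: deg_le_def)
    thus ?thesis using f(2) by (simp add: lookup_add)
  qed
  have "keys (t i) \<subseteq> keys (f * (Var v ^ n + B) ^ u)"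
    unfolding expand by (rule keys_sum_disjoint) (use i key in auto)
  hence tU: "keys (t i) \<subseteq> U" using sub by simp
  \<comment> \<open>The binomial coefficient is a unit in characteristic p; its inverse
    \<open>a\<close> strips it from \<open>t i\<close>.\<close>
  have "coprime (u choose i) CHAR('a)"
    using p prime_imp_coprime coprime_commute by blast
  then obtain a where "[(u choose i) * a = 1] (mod CHAR('a poly4))"
    using cong_solve_coprime_nat by (auto simp: CHAR_poly4)
  hence "of_nat ((u choose i) * a) = (1 :: 'a poly4)"
    using of_nat_eq_iff_cong_CHAR[of "(u choose i) * a" 1, where ?'a = "'a poly4"] by simp
  hence "f * Var v ^ (n * i) * B ^ (u - i) = t i * of_nat a"
    by (simp add: t_def mult_ac) (simp flip: mult.assoc)
  thus ?thesis using keys_mult_up_closed[OF U tU] by simp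
qed

section \<open>Normal forms modulo the quartic\<close>

definition gpoly :: "'a::comm_ring_1 poly4" where
  "gpoly = Var VX ^ 4 + Var VY ^ 4 + Var VZ ^ 4"

lemma fpoly_eq: "fpoly = gpoly + Var VW ^ 4"
  by (simp add: fpoly_def gpoly_def)

lemma deg_le_xyz_gpoly: "deg_le xyz_deg 4 gpoly"
  unfolding gpoly_def Var_power
  by (intro deg_le_add deg_le_single) (simp_all add: xyz_deg_def lookup_single)

lemma deg_ge_xyz_gpoly: "deg_ge xyz_deg 4 gpoly"
  unfolding gpoly_def Var_power
  by (intro deg_ge_add) (simp_all add: deg_ge_def xyz_deg_def lookup_single)

lemma deg_le_W_gpoly: "deg_le (expo VW) 0 gpoly"
  unfolding gpoly_def by (intro deg_le_add deg_le_Var_power) auto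

lemma gpoly_neq_0: "gpoly \<noteq> (0 :: 'a::comm_ring_1 poly4)"
proof
  have "Poly_Mapping.single u (4::nat) \<noteq> Poly_Mapping.single v 4" if "u \<noteq> v" for u v :: var
    by (metis lookup_single_eq lookup_single_not_eq that zero_neq_numeral)
  hence "lookup (gpoly :: 'a poly4) (Poly_Mapping.single VX 4) = 1"
    by (simp add: gpoly_def Var_power lookup_add lookup_single_not_eq)
  moreover assume "gpoly = (0 :: 'a poly4)"
  ultimately show False by simp
qed

text \<open>For an up-closed U this says that the monomial ideal is generated by monomials free of
  W.\<close>

definition w_free :: "(var \<Rightarrow>\<^sub>0 nat) set \<Rightarrow> bool" where
  "w_free U \<longleftrightarrow> (\<forall>k n. k + Poly_Mapping.single VW n \<in> U \<longrightarrow> k \<in> U)"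

text \<open>If the part of t outside U were nonzero, multiplying by F would raise its W-degree by exactly 4,
  and nothing else in the equation could cancel the resulting top terms.\<close>

lemma W_reduced_mem:
  fixes f m t :: "('p::prime_card mod_ring) poly4"
  assumes U: "up_closed U" "w_free U"
    and f: "deg_le (expo VW) 3 f" "f = m + fpoly * t" "keys m \<subseteq> U"
  shows "keys f \<subseteq> U"
proof -
  \<comment> \<open>The part \<open>s1\<close> contributes only terms in U and is absorbed into m;
    \<open>s2\<close> has to be shown zero.\<close>
  obtain s1 s2 where s: "t = s1 + s2" "keys s1 \<subseteq> U" "keys s2 \<subseteq> - U"
    by (rule poly_mapping_split[of t "\<lambda>k. k \<in> U"]) (auto simp: Compl_eq)
  define m' where "m' = m + s1 * fpoly"
  have m'U: "keys m' \<subseteq> U"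
    unfolding m'_def using keys_mult_up_closed[OF U(1) s(2)] f(3) keys_add by fastforce
  have eq: "f = m' + fpoly * s2"
    by (simp add: f(2) s(1) m'_def algebra_simps)
  have "s2 = 0"
  proof (rule ccontr)
    assume "s2 \<noteq> 0"
    hence ne: "keys s2 \<noteq> {}" by simp
    define d where "d = Max (expo VW ` keys s2)"
    have "d \<in> expo VW ` keys s2" unfolding d_def by (rule Max_in) (use ne in auto)
    then obtain k where k: "k \<in> keys s2" "expo VW k = d" by blast
    have dmax: "expo VW l \<le> d" if "l \<in> keys s2" for l
      using that by (simp add: d_def)
    obtain a b where ab: "s2 = a + b" "keys a \<subseteq> {k. expo VW k = d}" "keys b \<subseteq> {k. expo VW k \<noteq> d}"
      by (rule poly_mapping_split[of s2 "\<lambda>k. expo VW k = d"])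
    have a_ne: "a \<noteq> 0" using k ab by auto
    have disj: "keys a \<inter> keys b = {}" using ab(2,3) by auto
    have aU: "keys a \<subseteq> - U" using keys_add_disjoint[OF disj] s(3) ab(1) by auto
    have "keys b \<inter> keys a = {}" using disj by auto
    hence bs: "keys b \<subseteq> keys s2" using keys_add_disjoint[of b a] ab(1) by (simp add: add.commute)
    \<comment> \<open>The equation becomes \<open>top + rest = - m'\<close>, with the right side
      supported in U while \<open>top\<close> avoids U. So \<open>top\<close> would have to cancel
      against \<open>rest\<close>, whose W-degree is below d + 4; for f this is where the bound 3
      enters.\<close>
    define top where "top = a * Var VW ^ 4"
    define rest where "rest = gpoly * s2 + b * Var VW ^ 4 - f"
    have topkeys: "keys top \<subseteq> {\<kappa>. expo VW \<kappa> = d + 4 \<and> \<kappa> \<notin> U}"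
    proof
      fix \<kappa> assume "\<kappa> \<in> keys top"
      then obtain l where "l \<in> keys a" "\<kappa> = l + Poly_Mapping.single VW 4"
        using keys_mult[of a "Var VW ^ 4"] by (auto simp: top_def)
      thus "\<kappa> \<in> {\<kappa>. expo VW \<kappa> = d + 4 \<and> \<kappa> \<notin> U}"
        using ab(2) aU U(2) by (auto simp: lookup_add w_free_def)
    qed
    have "expo VW \<kappa> < d + 4" if "\<kappa> \<in> keys rest" for \<kappa>
    proof -
      have "\<kappa> \<in> keys (gpoly * s2) \<or> \<kappa> \<in> keys (b * Var VW ^ 4) \<or> \<kappa> \<in> keys f"
        using that keys_diff_subset[of "gpoly * s2 + b * Var VW ^ 4" f]
          keys_add[of "gpoly * s2" "b * Var VW ^ 4"] unfolding rest_def by blast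
      thus ?thesis
      proof (elim disjE)
        assume "\<kappa> \<in> keys (gpoly * s2)"
        moreover have "deg_le (expo VW) (0 + d) (gpoly * s2)"
          by (rule deg_le_mult[OF weight_expo deg_le_W_gpoly]) (use dmax in \<open>simp add: deg_le_def\<close>)
        ultimately show ?thesis by (auto simp: deg_le_def)
      next
        assume "\<kappa> \<in> keys (b * Var VW ^ 4)"
        then obtain l where "l \<in> keys b" "\<kappa> = l + Poly_Mapping.single VW 4"
          using keys_mult[of b "Var VW ^ 4"] by auto
        thus ?thesis using dmax[of l] bs ab(3) by (fastforce simp: lookup_add)
      qed (use f(1) in \<open>auto simp: deg_le_def\<close>)
    qed
    hence "keys top \<inter> keys rest = {}" using topkeys by fastforce
    hence "keys top \<subseteq> keys (top + rest)" by (rule keys_add_disjoint)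
    moreover have "top + rest = - m'"
      by (simp add: top_def rest_def eq ab(1) fpoly_eq algebra_simps)
    ultimately have "keys top \<subseteq> U" using m'U by (simp add: keys_uminus)
    hence "keys top = {}" using topkeys by blast
    moreover have "top \<noteq> 0" using a_ne by (simp add: top_def)
    ultimately show False by simp
  qed
  thus ?thesis using eq m'U by simp
qed

lemma fpoly_dvd_W_power: "fpoly dvd Var VW ^ (4 * n) - (- gpoly) ^ n"
proof -
  have "Var VW ^ 4 - (- gpoly) dvd (Var VW ^ 4) ^ n - (- gpoly) ^ n"
    by (simp add: power_diff_sumr2)
  thus ?thesis by (simp add: fpoly_eq add.commute power_mult)
qed

text \<open>Division with remainder by \<open>fpoly\<close>, which is monic of degree 4 in W,
  carried out on monomials: W^(4a + b) is replaced by (-g)^a W^b with b < 4.\<close>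

lemma W_reduce:
  obtains f' where "deg_le (expo VW) 3 f'" "fpoly dvd f - f'"
proof -
  have "\<exists>f'. deg_le (expo VW) 3 f' \<and> fpoly dvd f - f'"
  proof (rule poly4_monomial_decomp[of _ f])
    fix f g :: "'a mod_ring poly4"
    assume "\<exists>f'. deg_le (expo VW) 3 f' \<and> fpoly dvd f - f'"
      and "\<exists>g'. deg_le (expo VW) 3 g' \<and> fpoly dvd g - g'"
    then obtain f' g' where "deg_le (expo VW) 3 f'" "fpoly dvd f - f'"
      "deg_le (expo VW) 3 g'" "fpoly dvd g - g'" by blast
    thus "\<exists>h'. deg_le (expo VW) 3 h' \<and> fpoly dvd f + g - h'"
      by (intro exI[of _ "f' + g'"] conjI deg_le_add)
        (auto simp: add_diff_add)
  next
    show "\<exists>f'. deg_le (expo VW) 3 f' \<and> fpoly dvd 0 - f'"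
      by (intro exI[of _ 0]) (simp add: deg_le_def)
  next
    fix k and a :: "'a mod_ring"
    define n where "n = expo VW k"
    define k' where "k' = Poly_Mapping.update VW 0 k"
    have k: "k = k' + Poly_Mapping.single VW n"
      by (rule poly_mapping_eqI) (simp add: k'_def n_def lookup_add lookup_single lookup_update when_def)
    define s where "s = Poly_Mapping.single k' a * Var VW ^ (n mod 4)"
    have "Poly_Mapping.single k a = Poly_Mapping.single k' a * Var VW ^ (4 * (n div 4) + n mod 4)"
      by (simp add: k Var_power mult_single)
    also have "\<dots> = s * Var VW ^ (4 * (n div 4))"
      by (simp only: s_def power_add mult_ac)
    finally have "Poly_Mapping.single k a - s * (- gpoly) ^ (n div 4) =
        s * (Var VW ^ (4 * (n div 4)) - (- gpoly) ^ (n div 4))"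
      by (simp add: algebra_simps)
    hence "fpoly dvd Poly_Mapping.single k a - s * (- gpoly) ^ (n div 4)"
      using fpoly_dvd_W_power dvd_mult by metis
    moreover have "deg_le (expo VW) (n mod 4 + n div 4 * 0) (s * (- gpoly) ^ (n div 4))"
      unfolding s_def
      by (intro deg_le_mult deg_le_power deg_le_uminus deg_le_W_gpoly weight_expo)
        (simp add: deg_le_def Var_power mult_single k'_def lookup_add lookup_single lookup_update)
    hence "deg_le (expo VW) 3 (s * (- gpoly) ^ (n div 4))"
      by (rule deg_le_mono) simp
    ultimately show "\<exists>f'. deg_le (expo VW) 3 f' \<and> fpoly dvd Poly_Mapping.single k a - f'"
      by blast
  qed
  thus ?thesis using that by blast
qed

section \<open>Monomials with a large exponent\<close>

text \<open>The exponent vectors of the monomials in the ideal (X^q, Y^q, Z^q).\<close>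

definition frob_set :: "nat \<Rightarrow> (var \<Rightarrow>\<^sub>0 nat) set" where
  "frob_set q = {k. q \<le> expo VX k \<or> q \<le> expo VY k \<or> q \<le> expo VZ k}"

lemma up_closed_frob_set: "up_closed (frob_set q)"
  by (auto simp: up_closed_def frob_set_def lookup_add)

lemma w_free_frob_set: "w_free (frob_set q)"
  by (auto simp: w_free_def frob_set_def lookup_add lookup_single)

text \<open>The lift to the polynomial ring of the Frobenius power of I.\<close>

definition in_frob :: "nat \<Rightarrow> ('p::prime_card mod_ring) poly4 \<Rightarrow> bool" where
  "in_frob q f \<longleftrightarrow> (\<exists>m t. f = m + fpoly * t \<and> keys m \<subseteq> frob_set q)"

lemma in_frob_mult: "in_frob q f \<Longrightarrow> in_frob q (f * h)"
proof -
  assume "in_frob q f"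
  then obtain m t where mt: "f = m + fpoly * t" "keys m \<subseteq> frob_set q"
    by (auto simp: in_frob_def)
  have "f * h = m * h + fpoly * (t * h)" by (simp add: mt(1) algebra_simps)
  moreover have "keys (m * h) \<subseteq> frob_set q"
    using up_closed_frob_set mt(2) by (rule keys_mult_up_closed)
  ultimately show ?thesis unfolding in_frob_def by blast
qed

text \<open>Pigeonhole: three exponents that are all at most q - 1 add up to at most 3q - 3.\<close>

lemma deg_ge_imp_frob_set:
  assumes "deg_ge xyz_deg (3 * q - 2) f" and "q > 0"
  shows "keys f \<subseteq> frob_set q"
  using assms by (fastforce simp: deg_ge_def xyz_deg_def frob_set_def)

text \<open>W^(4n) equals (-g)^n modulo \<open>fpoly\<close>, and the surplus W^(m - 4n) is a mere
  multiple. The exponent m/4 is rounded down here and up in the converse below.\<close>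

lemma in_frob_W_power:
  assumes "keys (f * gpoly ^ n) \<subseteq> frob_set q" and "4 * n \<le> m"
  shows "in_frob q (f * Var VW ^ m)"
proof -
  obtain s where s: "Var VW ^ (4 * n) - (- gpoly) ^ n = fpoly * (s :: 'a mod_ring poly4)"
    using fpoly_dvd_W_power by (metis dvdE)
  have "f * Var VW ^ (4 * n) = f * gpoly ^ n * (- 1) ^ n + fpoly * (s * f)"
    using s by (simp add: power_minus[of gpoly] algebra_simps)
  moreover have "keys (f * gpoly ^ n * (- 1) ^ n) \<subseteq> frob_set q"
    using up_closed_frob_set assms(1) by (rule keys_mult_up_closed)
  ultimately have "in_frob q (f * Var VW ^ (4 * n))"
    unfolding in_frob_def by blast
  hence "in_frob q (f * Var VW ^ (4 * n) * Var VW ^ (m - 4 * n))"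
    by (rule in_frob_mult)
  thus ?thesis using assms(2) by (simp add: mult.assoc flip: power_add)
qed

text \<open>After W^m is raised to W^(4n) and replaced by (-g)^n, the polynomial still has W-degree
  at most 3. It is therefore its own normal form, and its membership can be read off its
  monomials.\<close>

lemma in_frob_W_powerD:
  assumes c: "deg_le (expo VW) 3 c" and "in_frob q (c * Var VW ^ m)" and "m \<le> 4 * n"
  shows "keys (c * gpoly ^ n) \<subseteq> frob_set q"
proof -
  obtain s where s: "Var VW ^ (4 * n) - (- gpoly) ^ n = fpoly * (s :: 'a mod_ring poly4)"
    using fpoly_dvd_W_power by (metis dvdE)
  have "in_frob q (c * Var VW ^ m * Var VW ^ (4 * n - m))"
    using assms(2) by (rule in_frob_mult)
  hence "in_frob q (c * Var VW ^ (4 * n))"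
    using assms(3) by (simp add: mult.assoc flip: power_add)
  then obtain f t where ft: "c * Var VW ^ (4 * n) = f + fpoly * t" "keys f \<subseteq> frob_set q"
    by (auto simp: in_frob_def)
  have "keys (c * (- gpoly) ^ n) \<subseteq> frob_set q"
  proof (rule W_reduced_mem[OF up_closed_frob_set w_free_frob_set _ _ ft(2)])
    have "deg_le (expo VW) (3 + n * 0) (c * (- gpoly) ^ n)"
      using c by (intro deg_le_mult deg_le_power deg_le_uminus deg_le_W_gpoly weight_expo)
    thus "deg_le (expo VW) 3 (c * (- gpoly) ^ n)" by simp
    show "c * (- gpoly) ^ n = f + fpoly * (t - c * s)"
      using ft(1) s by (simp add: algebra_simps)
  qed
  hence "keys (c * (- gpoly) ^ n * (- 1) ^ n) \<subseteq> frob_set q"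
    using up_closed_frob_set by (rule keys_mult_up_closed[rotated])
  thus ?thesis by (simp add: mult.assoc flip: power_mult_distrib)
qed

section \<open>Frobenius powers of g and separation of monomials\<close>

lemma frobenius_add:
  fixes f g :: "('p::prime_card mod_ring) poly4"
  shows "(f + g) ^ (CARD('p) ^ e) = f ^ (CARD('p) ^ e) + g ^ (CARD('p) ^ e)"
  by (rule freshmans_dream') (simp_all add: CHAR_poly4 semiring_char_mod_ring prime_card)

lemma gpoly_frobenius:
  "(gpoly :: ('p::prime_card mod_ring) poly4) ^ (CARD('p) ^ e) =
     Var VX ^ (4 * CARD('p) ^ e) + Var VY ^ (4 * CARD('p) ^ e) + Var VZ ^ (4 * CARD('p) ^ e)"
  by (simp add: gpoly_def frobenius_add flip: power_mult)

lemma keys_Var_power_frob_set: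
  assumes "v \<in> {VX, VY, VZ}" "q \<le> n"
  shows "keys (Var v ^ n :: 'a::comm_ring_1 poly4) \<subseteq> frob_set q"
  using assms by (auto simp: frob_set_def)

text \<open>By additivity of Frobenius only the three pure powers with exponent 4 p^e occur. This is
  the source of membership for p = 2 and p = 3.\<close>

lemma keys_gpoly_frobenius:
  assumes "q \<le> 4 * CARD('p) ^ e"
  shows "keys ((gpoly :: ('p::prime_card mod_ring) poly4) ^ (CARD('p) ^ e)) \<subseteq> frob_set q"
  unfolding gpoly_frobenius
  by (intro order.trans[OF keys_add] Un_least keys_Var_power_frob_set assms) simp_all

text \<open>Two binomial separations: first X from Y and Z, then Y from Z. Since u < p, no binomial
  coefficient that occurs is divisible by p.\<close>

lemma peel_trinomial:
  fixes f :: "('p::prime_card mod_ring) poly4"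
  assumes U: "up_closed U"
    and f: "deg_le xyz_deg r f" "r < n"
    and sub: "keys (f * (Var VX ^ n + Var VY ^ n + Var VZ ^ n) ^ u) \<subseteq> U"
    and i: "i + j \<le> u" "u < CARD('p)"
  shows "keys (f * Var VX ^ (n * i) * Var VY ^ (n * j) * Var VZ ^ (n * (u - i - j))) \<subseteq> U"
proof -
  have p: "prime CHAR('p mod_ring)" by (simp add: semiring_char_mod_ring prime_card)
  have nd: "\<not> CHAR('p mod_ring) dvd (w choose k)" if "w \<le> u" "k \<le> w" for w k
  proof
    assume "CHAR('p mod_ring) dvd (w choose k)"
    hence "CHAR('p mod_ring) dvd fact w"
      using binomial_fact_lemma[OF that(2)] by (metis dvd_mult)
    thus False using that i(2) p by (simp add: prime_dvd_fact_iff semiring_char_mod_ring)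
  qed
  have fX: "deg_le (expo VX) r f" and fY: "deg_le (expo VY) r f"
    using f(1) by (auto simp: deg_le_def xyz_deg_def)
  have "keys (f * Var VX ^ (n * i) * (Var VY ^ n + Var VZ ^ n) ^ (u - i)) \<subseteq> U"
  proof (rule peel_binomial[OF U fX f(2) _ _ _ p])
    show "deg_le (expo VX) 0 (Var VY ^ n + Var VZ ^ n :: 'p mod_ring poly4)"
      by (intro deg_le_add deg_le_Var_power) auto
  qed (use sub i nd in \<open>auto simp: add.assoc\<close>)
  moreover have "deg_le (expo VY) (r + 0) (f * Var VX ^ (n * i))"
    using fY by (intro deg_le_mult deg_le_Var_power weight_expo) auto
  ultimately have "keys (f * Var VX ^ (n * i) * Var VY ^ (n * j) * (Var VZ ^ n) ^ (u - i - j)) \<subseteq> U"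
    using f(2) i nd by (intro peel_binomial[where r = r and u = "u - i"] U p deg_le_Var_power) auto
  thus ?thesis by (simp add: power_mult)
qed

text \<open>The product is nonzero over a domain, so it has some monomial; h adds at most d to each
  exponent, hence none of the three reaches q.\<close>

lemma low_degree_not_frob:
  fixes h :: "'a::idom poly4"
  assumes "deg_le xyz_deg d h" "h \<noteq> 0"
    and sub: "keys (h * Var VX ^ i * Var VY ^ j * Var VZ ^ k) \<subseteq> frob_set q"
    and "d + i < q" "d + j < q" "d + k < q"
  shows False
proof -
  let ?f = "h * Var VX ^ i * Var VY ^ j * Var VZ ^ k"
  have h: "deg_le (expo v) d h" if "v \<noteq> VW" for v
    using assms(1) that by (cases v) (auto simp: deg_le_def xyz_deg_def)
  have "deg_le (expo VX) (d + i + 0 + 0) ?f" "deg_le (expo VY) (d + 0 + j + 0) ?f"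
      "deg_le (expo VZ) (d + 0 + 0 + k) ?f"
    by (intro deg_le_mult deg_le_Var_power h weight_expo; simp)+
  moreover have "?f \<noteq> 0" using assms(2) by simp
  then obtain \<kappa> where "\<kappa> \<in> keys ?f" using keys_eq_empty[of ?f] by blast
  ultimately have "expo VX \<kappa> \<le> d + i" "expo VY \<kappa> \<le> d + j" "expo VZ \<kappa> \<le> d + k"
    by (simp_all only: deg_le_def add_0_right)
  moreover have "\<kappa> \<in> frob_set q" using sub \<open>\<kappa> \<in> keys ?f\<close> by (rule subsetD)
  ultimately show False using assms(4-6) by (simp add: frob_set_def)
qed

lemma deg_le_mult_gpoly_power:
  "deg_le xyz_deg d c \<Longrightarrow> deg_le xyz_deg (d + n * 4) (c * gpoly ^ n)"
  by (intro deg_le_mult deg_le_power deg_le_xyz_gpoly) simp_all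

section \<open>Test elements\<close>

lemma power_add_mult: "a ^ (m + n * q) = a ^ m * (a ^ q) ^ n" for a :: "'a::comm_monoid_mult"
  by (simp add: power_add mult.commute flip: power_mult)

text \<open>In the next three lemmas the exponent N of g is such that 4N exceeds (k-1)q by at most 4, with q = 9Q, pQ and ppQ respectively.\<close>

lemma char3_not_frob:
  fixes c :: "('p::prime_card mod_ring) poly4"
  assumes p: "CARD('p) = 3" and c: "deg_le xyz_deg d c" "c \<noteq> 0"
    and Q: "Q = 3 ^ E" "d + 4 < Q"
  shows "\<not> keys (c * gpoly ^ (Q div 4 + 1 + 2 * Q)) \<subseteq> frob_set (9 * Q)"
proof
  define M where "M = Q div 4 + 1"
  assume "keys (c * gpoly ^ (Q div 4 + 1 + 2 * Q)) \<subseteq> frob_set (9 * Q)"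
  moreover have "c * gpoly ^ (Q div 4 + 1 + 2 * Q) = c * gpoly ^ M * (gpoly ^ Q) ^ 2"
    by (subst power_add_mult) (simp only: M_def mult.assoc)
  moreover have "gpoly ^ Q = (Var VX ^ (4 * Q) + Var VY ^ (4 * Q) + Var VZ ^ (4 * Q) :: 'p mod_ring poly4)"
    using gpoly_frobenius[where ?'p = 'p, of E] by (simp add: p Q(1))
  ultimately have sub: "keys (c * gpoly ^ M *
      (Var VX ^ (4 * Q) + Var VY ^ (4 * Q) + Var VZ ^ (4 * Q)) ^ 2) \<subseteq> frob_set (9 * Q)"
    by (simp only:)
  have deg: "deg_le xyz_deg (d + M * 4) (c * gpoly ^ M)"
    using c(1) by (rule deg_le_mult_gpoly_power)
  have dM: "d + M * 4 < 3 * Q" using Q(2) by (simp add: M_def)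
  \<comment> \<open>The term X^(4Q) Y^(4Q) of the square has coefficient 2. The cofactor has degree
    below 3Q, so all exponents stay below 7Q < 9Q.\<close>
  have "keys (c * gpoly ^ M * Var VX ^ (4 * Q * 1) * Var VY ^ (4 * Q * 1) *
      Var VZ ^ (4 * Q * (2 - 1 - 1))) \<subseteq> frob_set (9 * Q)"
    by (rule peel_trinomial[OF up_closed_frob_set deg _ sub]) (use p dM in auto)
  thus False
    by (rule low_degree_not_frob[OF deg, rotated]) (use c(2) dM in \<open>simp_all add: gpoly_neq_0\<close>)
qed

lemma char3mod4_not_frob:
  fixes c :: "('p::prime_card mod_ring) poly4"
  assumes p: "CARD('p) = 4 * s + 3" "s > 0" and c: "deg_le xyz_deg d c" "c \<noteq> 0"
    and Q: "Q = CARD('p) ^ E" "Q = 2 * M + 1" "d + 2 < Q"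
  shows "\<not> keys (c * gpoly ^ (M + 1 + (2 * s + 1) * Q)) \<subseteq> frob_set (CARD('p) * Q)"
proof
  assume "keys (c * gpoly ^ (M + 1 + (2 * s + 1) * Q)) \<subseteq> frob_set (CARD('p) * Q)"
  moreover have "c * gpoly ^ (M + 1 + (2 * s + 1) * Q) =
      c * gpoly ^ (M + 1) * (gpoly ^ Q) ^ (2 * s + 1)"
    by (subst power_add_mult) (simp only: mult.assoc)
  moreover have "gpoly ^ Q = (Var VX ^ (4 * Q) + Var VY ^ (4 * Q) + Var VZ ^ (4 * Q) :: 'p mod_ring poly4)"
    using gpoly_frobenius[where ?'p = 'p, of E] by (simp add: Q(1))
  ultimately have sub: "keys (c * gpoly ^ (M + 1) *
      (Var VX ^ (4 * Q) + Var VY ^ (4 * Q) + Var VZ ^ (4 * Q)) ^ (2 * s + 1)) \<subseteq> frob_set (CARD('p) * Q)"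
    by (simp only:)
  have deg: "deg_le xyz_deg (d + (M + 1) * 4) (c * gpoly ^ (M + 1))"
    using c(1) by (rule deg_le_mult_gpoly_power)
  \<comment> \<open>Here 4(M + 1) = 2Q + 2. The bound 3Q is exactly the room left by the exponent
    4sQ in pQ = 4sQ + 3Q.\<close>
  have dM: "d + (M + 1) * 4 < 3 * Q" using Q(2,3) by simp
  \<comment> \<open>The digit 2s + 1 is distributed as s to X, s to Y and 1 to Z.\<close>
  have main: "keys (c * gpoly ^ (M + 1) * Var VX ^ (4 * Q * s) * Var VY ^ (4 * Q * s) *
      Var VZ ^ (4 * Q * (2 * s + 1 - s - s))) \<subseteq> frob_set (CARD('p) * Q)"
    by (rule peel_trinomial[OF up_closed_frob_set deg _ sub]) (use p dM in auto)
  define x where "x = Q * s"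
  have "CARD('p) * Q = 4 * x + 3 * Q" by (simp add: p x_def algebra_simps)
  moreover have "Q \<le> x" using p(2) by (simp add: x_def)
  moreover have "4 * Q * s = 4 * x" "4 * Q * (2 * s + 1 - s - s) = 4 * Q" by (simp_all add: x_def)
  ultimately have "d + (M + 1) * 4 + 4 * Q * s < CARD('p) * Q"
      "d + (M + 1) * 4 + 4 * Q * (2 * s + 1 - s - s) < CARD('p) * Q"
    using dM by linarith+
  moreover have "c * gpoly ^ (M + 1) \<noteq> 0" using c(2) by (simp add: gpoly_neq_0)
  ultimately show False using low_degree_not_frob[OF deg _ main] by blast
qed

lemma char1mod4_not_frob:
  fixes c :: "('p::prime_card mod_ring) poly4"
  assumes p: "CARD('p) = 4 * s + 1" "s > 0" and c: "deg_le xyz_deg d c" "c \<noteq> 0"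
    and Q: "Q = CARD('p) ^ E" "Q = 2 * M + 1" "d + 2 < Q"
  shows "\<not> keys (c * gpoly ^ (M + 1 + 2 * s * Q + 2 * s * (CARD('p) * Q)))
    \<subseteq> frob_set (CARD('p) * CARD('p) * Q)"
proof
  let ?p = "CARD('p)"
  let ?U = "frob_set (?p * ?p * Q)"
  let ?h = "c * gpoly ^ (M + 1)"
  assume "keys (c * gpoly ^ (M + 1 + 2 * s * Q + 2 * s * (?p * Q))) \<subseteq> ?U"
  moreover have "c * gpoly ^ (M + 1 + 2 * s * Q + 2 * s * (?p * Q)) =
      c * gpoly ^ (M + 1 + 2 * s * Q) * (gpoly ^ (?p * Q)) ^ (2 * s)"
    by (subst power_add_mult) (simp only: mult.assoc)
  moreover have "gpoly ^ (?p * Q) = (Var VX ^ (4 * (?p * Q)) + Var VY ^ (4 * (?p * Q)) +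
      Var VZ ^ (4 * (?p * Q)) :: 'p mod_ring poly4)"
    using gpoly_frobenius[where ?'p = 'p, of "Suc E"] by (simp add: Q(1))
  ultimately have sub: "keys (c * gpoly ^ (M + 1 + 2 * s * Q) * (Var VX ^ (4 * (?p * Q)) +
      Var VY ^ (4 * (?p * Q)) + Var VZ ^ (4 * (?p * Q))) ^ (2 * s)) \<subseteq> ?U"
    by (simp only:)
  have deg1: "deg_le xyz_deg (d + (M + 1 + 2 * s * Q) * 4) (c * gpoly ^ (M + 1 + 2 * s * Q))"
    using c(1) by (rule deg_le_mult_gpoly_power)
  have pQ: "?p * Q = 4 * (s * Q) + Q" by (simp add: p algebra_simps)
  have "Q \<le> s * Q" using p(2) by simp
  hence dM1: "d + (M + 1 + 2 * s * Q) * 4 < 4 * (?p * Q)"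
    using Q(2,3) unfolding pQ by (simp add: mult.assoc)
  \<comment> \<open>The high digit 2s is split evenly between X and Y. Their exponents 4spQ then
    fall short of ppQ by pQ.\<close>
  have "keys (c * gpoly ^ (M + 1 + 2 * s * Q) * Var VX ^ (4 * (?p * Q) * s) *
      Var VY ^ (4 * (?p * Q) * s) * Var VZ ^ (4 * (?p * Q) * (2 * s - s - s))) \<subseteq> ?U"
    by (rule peel_trinomial[OF up_closed_frob_set deg1 dM1 sub]) (use p in auto)
  \<comment> \<open>The total degree of f is now large because of the split-off powers of X and Y,
    but its Z-degree is still below 3Q. So the low digit is separated by a binomial expansion in
    Z^(4Q) alone.\<close>
  moreover define f where "f = ?h * Var VX ^ (4 * (?p * Q) * s) * Var VY ^ (4 * (?p * Q) * s)"
  have "c * gpoly ^ (M + 1 + 2 * s * Q) = ?h * (gpoly ^ Q) ^ (2 * s)"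
    by (subst power_add_mult) (simp only: mult.assoc)
  hence "c * gpoly ^ (M + 1 + 2 * s * Q) * Var VX ^ (4 * (?p * Q) * s) *
      Var VY ^ (4 * (?p * Q) * s) * Var VZ ^ (4 * (?p * Q) * (2 * s - s - s)) = f * (gpoly ^ Q) ^ (2 * s)"
    by (simp add: f_def mult_ac)
  moreover have "gpoly ^ Q = (Var VZ ^ (4 * Q) + (Var VX ^ (4 * Q) + Var VY ^ (4 * Q)) :: 'p mod_ring poly4)"
    using gpoly_frobenius[where ?'p = 'p, of E] by (simp add: Q(1) add_ac)
  ultimately have sub2: "keys (f * (Var VZ ^ (4 * Q) + (Var VX ^ (4 * Q) + Var VY ^ (4 * Q))) ^ (2 * s)) \<subseteq> ?U"
    by (simp only:)
  have deg: "deg_le xyz_deg (d + (M + 1) * 4) ?h"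
    using c(1) by (rule deg_le_mult_gpoly_power)
  have "deg_le (expo VZ) (d + (M + 1) * 4) ?h"
    using deg by (auto simp: deg_le_def xyz_deg_def)
  hence degf: "deg_le (expo VZ) (d + (M + 1) * 4 + 0 + 0) f"
    unfolding f_def by (intro deg_le_mult[OF _ deg_le_mult] deg_le_Var_power weight_expo) auto
  have dM: "d + (M + 1) * 4 < 3 * Q" using Q(2,3) by simp
  \<comment> \<open>The low digit 2s goes entirely to Z, which received nothing from the high digit;
    the coefficient is 1.\<close>
  have "keys (f * Var VZ ^ (4 * Q * (2 * s)) *
      (Var VX ^ (4 * Q) + Var VY ^ (4 * Q)) ^ (2 * s - 2 * s)) \<subseteq> ?U"
  proof (rule peel_binomial[OF up_closed_frob_set degf _ _ sub2])
    show "deg_le (expo VZ) 0 (Var VX ^ (4 * Q) + Var VY ^ (4 * Q) :: 'p mod_ring poly4)"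
      by (intro deg_le_add deg_le_Var_power) auto
  next
    show "\<not> CHAR('p mod_ring) dvd (2 * s choose (2 * s))"
      using prime_gt_1_nat[OF prime_card, where ?'a1 = 'p] by (simp add: semiring_char_mod_ring)
  qed (use dM in \<open>auto simp: semiring_char_mod_ring prime_card\<close>)
  hence main: "keys (?h * Var VX ^ (4 * (?p * Q) * s) * Var VY ^ (4 * (?p * Q) * s) *
      Var VZ ^ (4 * Q * (2 * s))) \<subseteq> ?U"
    by (simp add: f_def)
  define x where "x = s * Q"
  define y where "y = s * (?p * Q)"
  have "?p * ?p * Q = ?p * (?p * Q)" by simp
  also have "\<dots> = 4 * s * (?p * Q) + ?p * Q" by (subst (1) p) (simp only: distrib_right mult_1)
  finally have "?p * ?p * Q = 4 * y + ?p * Q" by (simp add: y_def)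
  moreover have "?p * Q = 4 * x + Q" using pQ by (simp add: x_def)
  moreover have "3 * Q \<le> ?p * Q" using p by simp
  moreover have "x \<le> y" by (simp add: x_def y_def)
  moreover have "4 * (?p * Q) * s = 4 * y" "4 * Q * (2 * s) = 8 * x" by (simp_all add: x_def y_def)
  moreover have "?p * Q \<le> y" using p(2) by (simp add: y_def)
  ultimately have "d + (M + 1) * 4 + 4 * (?p * Q) * s < ?p * ?p * Q"
      "d + (M + 1) * 4 + 4 * Q * (2 * s) < ?p * ?p * Q"
    using dM by linarith+
  moreover have "?h \<noteq> 0" using c(2) by (simp add: gpoly_neq_0)
  ultimately show False using low_degree_not_frob[OF deg _ main] by blast
qed

lemma less_prime_card_power: "n < CARD('p::prime_card) ^ n"
proof -
  have "n < 2 ^ n" by (rule less_exp)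
  also have "\<dots> \<le> CARD('p) ^ n" using prime_ge_2_nat[OF prime_card] by (rule power_mono) simp
  finally show ?thesis .
qed

text \<open>The pairs (p, k) for which I + m^k is the claimed tight closure.\<close>

definition closure_order :: "nat \<Rightarrow> nat \<Rightarrow> bool" where
  "closure_order p k \<longleftrightarrow> p = 2 \<and> k = 1 \<or> p = 3 \<and> k = 2 \<or> p \<ge> 5 \<and> k = 3"

text \<open>Choosing Q = p^E with d + 4 < Q, where d bounds the degree of c, meets the degree
  hypotheses of the digit arguments; these are applied at q = Q, 9Q, ppQ or pQ. The summand
  \<open>e0\<close> in E secures the lower bound on e.\<close>

lemma reduced_not_in_frob:
  fixes c :: "('p::prime_card mod_ring) poly4"
  assumes pk: "closure_order CARD('p) k" and c: "deg_le (expo VW) 3 c" "c \<noteq> 0"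
  obtains e where "e \<ge> e0" "\<not> in_frob (CARD('p) ^ e) (c * Var VW ^ ((k - 1) * CARD('p) ^ e))"
proof -
  let ?p = "CARD('p)"
  obtain d where d: "deg_le xyz_deg d c" by (rule deg_le_exists)
  define E where "E = d + 4 + e0"
  define Q where "Q = ?p ^ E"
  have Q: "d + 4 < Q" "Q = ?p ^ E"
    using less_prime_card_power[where ?'p = 'p, of E] by (auto simp: Q_def E_def)
  note witness = that
  have *: thesis if h: "e \<ge> E" "(k - 1) * ?p ^ e \<le> 4 * n"
    "\<not> keys (c * gpoly ^ n) \<subseteq> frob_set (?p ^ e)" for e n
    by (rule witness[of e]) (use h in_frob_W_powerD[OF c(1)] in \<open>auto simp: E_def\<close>)
  consider "?p = 2" "k = 1" | "?p = 3" "k = 2" | s where "?p = 4 * s + 1" "s > 0" "k = 3"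
    | s where "?p = 4 * s + 3" "s > 0" "k = 3"
  proof -
    have "?p = 4 * (?p div 4) + 1 \<or> ?p = 4 * (?p div 4) + 3" if "?p \<ge> 5"
      using prime_odd_nat[OF prime_card, where ?'a1 = 'p] that by presburger
    thus thesis using pk that by (auto simp: closure_order_def)
  qed
  thus thesis
  proof cases
    case 1
    \<comment> \<open>Here k - 1 = 0, so no power of g occurs and c itself has degree below
      q.\<close>
    have "\<not> keys (c * Var VX ^ 0 * Var VY ^ 0 * Var VZ ^ 0) \<subseteq> frob_set (?p ^ E)"
      using low_degree_not_frob[OF d c(2)] Q by fastforce
    thus thesis using 1 by (intro *[of E 0]) auto
  next
    case 2
    have "\<not> keys (c * gpoly ^ (Q div 4 + 1 + 2 * Q)) \<subseteq> frob_set (?p ^ (E + 2))"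
      using char3_not_frob[OF 2(1) d c(2), of Q E] Q by (simp add: 2 power_add mult.commute)
    thus thesis using 2 Q by (intro *[of "E + 2" "Q div 4 + 1 + 2 * Q"]) (auto simp: power_add)
  next
    case (3 s)
    have "odd Q" by (simp add: Q(2) 3)
    then obtain M where M: "Q = 2 * M + 1" by (metis oddE)
    have "\<not> keys (c * gpoly ^ (M + 1 + 2 * s * Q + 2 * s * (?p * Q))) \<subseteq> frob_set (?p ^ (E + 2))"
      using char1mod4_not_frob[OF 3(1,2) d c(2) Q(2) M] Q
      by (simp add: power_add mult_ac power2_eq_square)
    moreover have "(k - 1) * ?p ^ (E + 2) \<le> 4 * (M + 1 + 2 * s * Q + 2 * s * (?p * Q))"
    proof -
      have "?p ^ (E + 2) = ?p * ?p * Q" by (simp add: Q(2) power_add power2_eq_square mult_ac)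
      also have "\<dots> = 4 * s * (?p * Q) + (4 * s * Q + Q)" by (simp add: 3(1) algebra_simps)
      finally show ?thesis by (simp add: 3(3) M algebra_simps)
    qed
    ultimately show thesis by (intro *[rotated, rotated]) (assumption | simp)+
  next
    case (4 s)
    have "odd Q" by (simp add: Q(2) 4)
    then obtain M where M: "Q = 2 * M + 1" by (metis oddE)
    have "\<not> keys (c * gpoly ^ (M + 1 + (2 * s + 1) * Q)) \<subseteq> frob_set (?p ^ (E + 1))"
      using char3mod4_not_frob[OF 4(1,2) d c(2) Q(2) M] Q by (simp add: mult_ac)
    moreover have "(k - 1) * ?p ^ (E + 1) \<le> 4 * (M + 1 + (2 * s + 1) * Q)"
    proof -
      have "?p ^ (E + 1) = ?p * Q" by (simp add: Q(2) mult_ac)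
      also have "\<dots> = 4 * s * Q + 3 * Q" by (simp add: 4(1) algebra_simps)
      finally show ?thesis by (simp add: 4(3) M algebra_simps)
    qed
    ultimately show thesis by (intro *[rotated, rotated]) (assumption | simp)+
  qed
qed

text \<open>Replacing c by its remainder of W-degree at most 3 preserves all memberships, and a
  nonzero remainder is excluded by the digit arguments.\<close>

lemma not_in_frob:
  fixes c :: "('p::prime_card mod_ring) poly4"
  assumes pk: "closure_order CARD('p) k"
    and c: "\<And>e. e \<ge> e0 \<Longrightarrow> in_frob (CARD('p) ^ e) (c * Var VW ^ ((k - 1) * CARD('p) ^ e))"
  shows "fpoly dvd c"
proof -
  obtain c' where c': "deg_le (expo VW) 3 c'" "fpoly dvd c - c'" by (rule W_reduce)
  from c'(2) obtain s where s: "c' = c - fpoly * s" by (metis dvdE diff_diff_eq2 add_diff_cancel_left')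
  have "in_frob (CARD('p) ^ e) (c' * Var VW ^ ((k - 1) * CARD('p) ^ e))" if e: "e \<ge> e0" for e
  proof -
    obtain m t where mt: "c * Var VW ^ ((k - 1) * CARD('p) ^ e) = m + fpoly * t"
      "keys m \<subseteq> frob_set (CARD('p) ^ e)"
      using c[OF e] by (auto simp: in_frob_def)
    have "c' * Var VW ^ ((k - 1) * CARD('p) ^ e) =
        m + fpoly * (t - s * Var VW ^ ((k - 1) * CARD('p) ^ e))"
      using mt(1) by (simp add: s algebra_simps)
    thus ?thesis using mt(2) unfolding in_frob_def by blast
  qed
  hence "c' = 0" using reduced_not_in_frob[OF pk c'(1), of e0] by blast
  thus ?thesis using c'(2) by simp
qed

text \<open>This makes X available as the multiplier in the definition of tight closure. The bound
  on e makes q divisible by 4 when p = 2.\<close>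

lemma X_W_in_frob:
  assumes pk: "closure_order CARD('p::prime_card) k" and "e \<ge> 2"
  shows "in_frob (CARD('p) ^ e) (Var VX * Var VW ^ (k * CARD('p) ^ e) :: 'p mod_ring poly4)"
proof -
  let ?p = "CARD('p)" and ?X = "Var VX :: 'p mod_ring poly4"
  \<comment> \<open>For p = 2, 3 a power g^(p^i) with p^i between q/4 and kq/4 is enough: i = e - 2
    and i = e - 1 respectively.\<close>
  have small: ?thesis if "?p ^ e \<le> 4 * ?p ^ i" "4 * ?p ^ i \<le> k * ?p ^ e" for i
  proof (rule in_frob_W_power[OF _ that(2)])
    have "keys ((gpoly :: 'p mod_ring poly4) ^ (?p ^ i) * ?X) \<subseteq> frob_set (?p ^ e)"
      using up_closed_frob_set keys_gpoly_frobenius[OF that(1)] by (rule keys_mult_up_closed)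
    thus "keys (?X * gpoly ^ (?p ^ i)) \<subseteq> frob_set (?p ^ e)" by (simp add: mult.commute)
  qed
  from pk consider "?p = 2" "k = 1" | "?p = 3" "k = 2" | "?p \<ge> 5" "k = 3"
    by (auto simp: closure_order_def)
  thus ?thesis
  proof cases
    case 1
    have "?p ^ e = 2 ^ 2 * 2 ^ (e - 2)"
      by (simp only: 1 le_add_diff_inverse[OF assms(2)] flip: power_add)
    thus ?thesis using 1 by (intro small[of "e - 2"]) auto
  next
    case 2
    have "?p ^ e = 3 * 3 ^ (e - 1)" using \<open>e \<ge> 2\<close> 2 by (simp flip: power_Suc)
    thus ?thesis using 2 by (intro small[of "e - 1"]) auto
  next
    case 3
    let ?q = "?p ^ e" let ?n = "3 * ?q div 4"
    \<comment> \<open>Since 3q is odd, rounding it down to a multiple of 4 loses at most 3; the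
      factor X restores the degree 3q - 2.\<close>
    have "odd ?q" using prime_odd_nat[OF prime_card, where ?'a1 = 'p] 3 by auto
    hence n: "3 * ?q - 2 \<le> 1 + ?n * 4" "4 * ?n \<le> 3 * ?q" by presburger+
    have "deg_ge xyz_deg (1 + ?n * 4) (?X * gpoly ^ ?n)"
      by (intro deg_ge_mult deg_ge_power deg_ge_xyz_gpoly)
        (simp_all add: deg_ge_def Var_def xyz_deg_def lookup_single)
    hence "deg_ge xyz_deg (3 * ?q - 2) (?X * gpoly ^ ?n)"
      using n(1) unfolding deg_ge_def by fastforce
    hence "keys (?X * gpoly ^ ?n) \<subseteq> frob_set ?q"
      by (rule deg_ge_imp_frob_set) (use 3 in simp)
    thus ?thesis using n(2) 3 by (intro in_frob_W_power[of _ ?n]) auto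
  qed
qed

text \<open>Multiplication by X keeps the W-degree at most 3, and a multiple of \<open>fpoly\<close>
  with that bound vanishes, by \<open>W_reduced_mem\<close> with U empty.\<close>

lemma fpoly_dvd_X_mult:
  fixes c :: "('p::prime_card mod_ring) poly4"
  assumes "fpoly dvd Var VX * c"
  shows "fpoly dvd c"
proof -
  obtain c' where c': "deg_le (expo VW) 3 c'" "fpoly dvd c - c'" by (rule W_reduce)
  have "fpoly dvd Var VX * c - Var VX * (c - c')"
    by (intro dvd_diff assms dvd_mult c'(2))
  hence "fpoly dvd Var VX * c'" by (simp add: algebra_simps)
  then obtain t where t: "Var VX * c' = 0 + fpoly * t" by (auto elim: dvdE)
  have "deg_le (expo VW) (0 + 3) (Var VX * c')"
    using deg_le_Var_power(2)[of VX VW 1] c'(1) by (intro deg_le_mult) auto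
  hence "keys (Var VX * c') \<subseteq> {}"
    by (intro W_reduced_mem[OF _ _ _ t]) (auto simp: up_closed_def w_free_def)
  hence "c' = 0" by simp
  thus ?thesis using c'(2) by simp
qed

section \<open>Minimal primes of commutative rings\<close>

text \<open>Zorn gives an ideal maximal among those disjoint from the multiplicative set T, and
  maximality forces it to be prime.\<close>

lemma (in cring) exists_primeideal_disjoint:
  assumes T: "T \<subseteq> carrier R" "\<one> \<in> T" "\<zero> \<notin> T" "\<And>a b. \<lbrakk>a \<in> T; b \<in> T\<rbrakk> \<Longrightarrow> a \<otimes> b \<in> T"
  obtains P where "primeideal P R" "P \<inter> T = {}"
proof -
  define A where "A = {I. ideal I R \<and> I \<inter> T = {}}"
  have "\<exists>M\<in>A. \<forall>X\<in>A. M \<subseteq> X \<longrightarrow> X = M"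
  proof (rule subset_Zorn_nonempty)
    show "A \<noteq> {}" using zeroideal T(3) by (auto simp: A_def)
  next
    fix C assume C: "C \<noteq> {}" "subset.chain A C"
    hence "subset.chain {I. ideal I R} C"
      by (auto simp: subset_chain_def A_def)
    hence "ideal (\<Union>C) R" using chain_Union_is_ideal[of C] C(1) by simp
    thus "\<Union>C \<in> A" using C(2) by (auto simp: subset_chain_def A_def)
  qed
  then obtain M where M: "ideal M R" "M \<inter> T = {}"
    and max: "\<And>X. \<lbrakk>ideal X R; X \<inter> T = {}; M \<subseteq> X\<rbrakk> \<Longrightarrow> X = M"
    by (auto simp: A_def)
  interpret M: ideal M R by (rule M(1))
  have meets: "\<exists>m\<in>M. \<exists>r\<in>carrier R. m \<oplus> r \<otimes> a \<in> T" if a: "a \<in> carrier R" "a \<notin> M" for a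
  proof (rule ccontr)
    assume no: "\<not> ?thesis"
    have "M <+> PIdl a = M"
    proof (rule max)
      show "ideal (M <+> PIdl a) R" by (intro add_ideals M(1) cgenideal_ideal a)
      show "(M <+> PIdl a) \<inter> T = {}" using no by (auto simp: set_add_def' cgenideal_def)
      show "M \<subseteq> M <+> PIdl a"
      proof
        fix x assume "x \<in> M"
        moreover have "\<zero> \<in> PIdl a"
          using cgenideal_ideal[OF a(1)] by (simp add: additive_subgroup.zero_closed ideal_def)
        ultimately show "x \<in> M <+> PIdl a" by (force simp: set_add_def')
      qed
    qed
    moreover have "\<zero> \<oplus> a \<in> M <+> PIdl a"
      using cgenideal_self[OF a(1)] M.zero_closed unfolding set_add_def' by blast
    ultimately show False using a by simp
  qed
  have "primeideal M R"
  proof (rule primeidealI[OF M(1) is_cring])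
    show "carrier R \<noteq> M" using M(2) T(1,2) by blast
  next
    fix a b assume ab: "a \<in> carrier R" "b \<in> carrier R" "a \<otimes> b \<in> M"
    show "a \<in> M \<or> b \<in> M"
    proof (rule ccontr)
      assume "\<not> (a \<in> M \<or> b \<in> M)"
      then obtain m n r s where mr: "m \<in> M" "r \<in> carrier R" "m \<oplus> r \<otimes> a \<in> T"
        and ns: "n \<in> M" "s \<in> carrier R" "n \<oplus> s \<otimes> b \<in> T"
        using meets ab(1,2) by metis
      note [simp] = ab(1,2) mr(2) ns(2) M.Icarr[OF mr(1)] M.Icarr[OF ns(1)]
      \<comment> \<open>The product of the two elements of T is again in T, yet each of its terms
        has a factor m, n or ab in M.\<close>
      have "(r \<otimes> a) \<otimes> (s \<otimes> b) = (r \<otimes> s) \<otimes> (a \<otimes> b)"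
        by (simp add: m_ac)
      hence "(m \<oplus> r \<otimes> a) \<otimes> (n \<oplus> s \<otimes> b) =
          (m \<otimes> (n \<oplus> s \<otimes> b) \<oplus> (r \<otimes> a) \<otimes> n) \<oplus> (r \<otimes> s) \<otimes> (a \<otimes> b)"
        by (simp add: l_distr r_distr a_ac)
      also have "\<dots> \<in> M"
        by (intro M.a_closed M.I_r_closed[OF mr(1)] M.I_l_closed[OF ns(1)] M.I_l_closed[OF ab(3)])
          auto
      finally show False using T(4)[OF mr(3) ns(3)] M(2) by blast
    qed
  qed
  thus thesis using M(2) that by blast
qed

text \<open>Zorn is applied to complements of primes, which turns minimality into maximality; a
  chain is bounded because the intersection of a chain of primes is prime.\<close>

lemma (in cring) exists_minimal_prime:
  assumes "\<one> \<noteq> \<zero>"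
  obtains P where "minimal_prime R P"
proof -
  define A where "A = {carrier R - P |P. primeideal P R}"
  have "\<exists>M\<in>A. \<forall>X\<in>A. M \<subseteq> X \<longrightarrow> X = M"
  proof (rule subset_Zorn_nonempty)
    obtain P where "primeideal P R"
      by (rule exists_primeideal_disjoint[of "{\<one>}"]) (use assms in auto)
    thus "A \<noteq> {}" by (auto simp: A_def)
  next
    fix C assume C: "C \<noteq> {}" "subset.chain A C"
    define S where "S = {P. primeideal P R \<and> carrier R - P \<in> C}"
    have inC: "\<exists>P\<in>S. X = carrier R - P" if "X \<in> C" for X
      using that C(2) by (auto simp: subset_chain_def A_def S_def)
    have "S \<noteq> {}" using C(1) inC by blast
    have "primeideal (\<Inter>S) R"
    proof (rule primeidealI[OF i_Intersect is_cring])
      show "ideal I R" if "I \<in> S" for I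
        using that by (auto simp: S_def primeideal_def)
      show "S \<noteq> {}" by fact
      obtain P where P: "P \<in> S" using \<open>S \<noteq> {}\<close> by blast
      hence "carrier R \<noteq> P" "P \<subseteq> carrier R"
        using primeideal.I_notcarr primeideal.axioms(1) ideal.Icarr by (fastforce simp: S_def)+
      thus "carrier R \<noteq> \<Inter>S" using P by blast
    next
      fix a b assume ab: "a \<in> carrier R" "b \<in> carrier R" "a \<otimes> b \<in> \<Inter>S"
      show "a \<in> \<Inter>S \<or> b \<in> \<Inter>S"
      proof (rule ccontr)
        assume "\<not> (a \<in> \<Inter>S \<or> b \<in> \<Inter>S)"
        then obtain P Q where PQ: "P \<in> S" "Q \<in> S" "a \<notin> P" "b \<notin> Q" by blast
        \<comment> \<open>P and Q are nested, so the smaller one contains neither a nor b.\<close>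
        have "carrier R - P \<subseteq> carrier R - Q \<or> carrier R - Q \<subseteq> carrier R - P"
          using C(2) PQ(1,2) by (auto simp: subset_chain_def S_def)
        then obtain K where "K \<in> S" "a \<notin> K" "b \<notin> K" using PQ ab(1,2) by blast
        thus False using ab primeideal.I_prime[of K R a b] by (auto simp: S_def)
      qed
    qed
    moreover have "\<Union>C = carrier R - \<Inter>S"
      using inC by (auto simp: S_def)
    ultimately show "\<Union>C \<in> A" by (auto simp: A_def)
  qed
  then obtain P where P: "primeideal P R"
    and max: "\<And>Q. \<lbrakk>primeideal Q R; carrier R - P \<subseteq> carrier R - Q\<rbrakk> \<Longrightarrow> carrier R - Q = carrier R - P"
    by (auto simp: A_def)
  have carr: "Q \<subseteq> carrier R" if "primeideal Q R" for Q
    using that ideal.Icarr by (auto simp: primeideal_def)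
  have "Q = P" if Q: "primeideal Q R" "Q \<subseteq> P" for Q
    using max[OF Q(1)] Q(2) carr[OF P] carr[OF Q(1)] by blast
  with P have "minimal_prime R P" by (auto simp: minimal_prime_def)
  thus thesis by (rule that)
qed

text \<open>The products c^n s with s outside P form a multiplicative set without zero. A prime
  disjoint from it lies inside P and omits c, so minimality of P forbids c in P.\<close>

lemma (in cring) nonzerodivisor_not_in_minimal_prime:
  assumes c: "c \<in> carrier R" "\<And>s. \<lbrakk>s \<in> carrier R; c \<otimes> s = \<zero>\<rbrakk> \<Longrightarrow> s = \<zero>"
    and P: "minimal_prime R P"
  shows "c \<notin> P"
proof
  assume "c \<in> P"
  have prime: "primeideal P R" and min: "\<And>Q. \<lbrakk>primeideal Q R; Q \<subseteq> P\<rbrakk> \<Longrightarrow> Q = P"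
    using P by (auto simp: minimal_prime_def)
  interpret P: primeideal P R by (rule prime)
  have one: "\<one> \<notin> P" using P.I_notcarr P.one_imp_carrier by blast
  define T where "T = {c [^] (n::nat) \<otimes> s |n s. s \<in> carrier R - P}"
  obtain Q where Q: "primeideal Q R" "Q \<inter> T = {}"
  proof (rule exists_primeideal_disjoint[of T])
    show "T \<subseteq> carrier R" using c(1) by (auto simp: T_def)
    have "\<one> = c [^] (0::nat) \<otimes> \<one>" by simp
    thus "\<one> \<in> T" unfolding T_def using one by blast
    show "\<zero> \<notin> T"
    proof
      assume "\<zero> \<in> T"
      then obtain n :: nat and s where s: "c [^] n \<otimes> s = \<zero>" "s \<in> carrier R - P"
        by (auto simp: T_def)
      have "c [^] n \<otimes> s = \<zero> \<Longrightarrow> s = \<zero>"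
      proof (induction n)
        case (Suc n)
        have "c \<otimes> (c [^] n \<otimes> s) = \<zero>"
          using Suc.prems c(1) s(2) by (simp add: m_assoc[symmetric] m_comm)
        hence "c [^] n \<otimes> s = \<zero>" by (rule c(2)[rotated]) (use c(1) s(2) in auto)
        thus ?case by (rule Suc.IH)
      qed (use s(2) in auto)
      thus False using s P.zero_closed by auto
    qed
    show "a \<otimes> b \<in> T" if ab: "a \<in> T" "b \<in> T" for a b
    proof -
      obtain n m :: nat and s t where ns: "a = c [^] n \<otimes> s" "s \<in> carrier R - P"
        and mt: "b = c [^] m \<otimes> t" "t \<in> carrier R - P"
        using ab by (auto simp: T_def)
      have "a \<otimes> b = c [^] (n + m) \<otimes> (s \<otimes> t)"
        using c(1) ns mt by (simp add: m_ac flip: nat_pow_mult)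
      moreover have "s \<otimes> t \<in> carrier R - P" using ns(2) mt(2) P.I_prime by auto
      ultimately show ?thesis unfolding T_def by blast
    qed
  qed
  interpret Q: primeideal Q R by (rule Q(1))
  have inT: "c [^] n \<otimes> s \<in> T" if "s \<in> carrier R - P" for n :: nat and s
    using that unfolding T_def by blast
  have "Q \<subseteq> P"
  proof
    fix x assume x: "x \<in> Q"
    show "x \<in> P"
    proof (rule ccontr)
      assume "x \<notin> P"
      hence "c [^] (0::nat) \<otimes> x \<in> T" using x Q.Icarr by (intro inT) auto
      thus False using x Q(2) Q.Icarr[OF x] by auto
    qed
  qed
  moreover have "c \<notin> Q"
  proof
    assume "c \<in> Q"
    have "c [^] (1::nat) \<otimes> \<one> \<in> T" using one by (intro inT) auto
    thus False using \<open>c \<in> Q\<close> Q(2) c(1) by auto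
  qed
  ultimately show False using min[OF Q(1)] \<open>c \<in> P\<close> by blast
qed

section \<open>Spans in the polynomial ring\<close>

text \<open>With the ring as a module over itself, \<open>rspan.span G\<close> is the ideal
  generated by G.\<close>

interpretation rspan: Modules.module "(*) :: 'a::comm_ring_1 \<Rightarrow> 'a \<Rightarrow> 'a"
  by standard (auto simp: algebra_simps)

text \<open>This rule loops with associativity-commutativity rewriting.\<close>

declare rspan.scale_scale [simp del]

lemma rspan_insert_iff: "f \<in> rspan.span (insert a G) \<longleftrightarrow> (\<exists>k. f - k * a \<in> rspan.span G)"
  by (simp add: rspan.span_insert)

text \<open>Used with w = W^j and v = W: a coefficient split as constant plus multiple of W sends
  its second part to the next power of W.\<close>

lemma rspan_diff_substitute:
  assumes "f - r * w \<in> rspan.span G" and "r - a - s * v \<in> rspan.span G"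
  shows "f - a * w - s * (v * w) \<in> rspan.span G"
proof -
  have "f - r * w + w * (r - a - s * v) \<in> rspan.span G"
    using assms by (intro rspan.span_add rspan.span_scale)
  thus ?thesis by (simp add: algebra_simps)
qed

text \<open>Additivity of Frobenius lets the power act on each term of a linear combination.\<close>

lemma rspan_power:
  fixes G :: "'a::comm_ring_1 set"
  assumes "f \<in> rspan.span G" "prime CHAR('a)"
  shows "f ^ (CHAR('a) ^ e) \<in> rspan.span ((\<lambda>g. g ^ (CHAR('a) ^ e)) ` G)"
  using assms(1)
proof (induction rule: rspan.span_induct_alt)
  case base
  show ?case using assms(2) by (simp add: rspan.span_zero power_0_left)
next
  case (step c x y)
  thus ?case
    by (simp add: freshmans_dream'[OF assms(2)] power_mult_distrib rspan.span_add rspan.span_scale rspan.span_base)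
qed

abbreviation xyz_powers :: "nat \<Rightarrow> ('p::prime_card mod_ring) poly4 set" where
  "xyz_powers q \<equiv> (\<lambda>v. Var v ^ q) ` {VX, VY, VZ}"

text \<open>Each monomial in \<open>frob_set q\<close> is a multiple of one of the generators, and
  multiples of the generators have only such monomials.\<close>

lemma xyz_powers_span_iff: "f \<in> rspan.span (xyz_powers q) \<longleftrightarrow> keys f \<subseteq> frob_set q"
proof
  assume "f \<in> rspan.span (xyz_powers q)"
  thus "keys f \<subseteq> frob_set q"
  proof (induction rule: rspan.span_induct_alt)
    case (step c x y)
    have "keys (x * c) \<subseteq> frob_set q"
      using step(1) keys_Var_power_frob_set[of _ q q]
      by (intro keys_mult_up_closed[OF up_closed_frob_set]) auto
    thus ?case using step(2) keys_add[of "c * x" y] by (auto simp: mult.commute)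
  qed simp
next
  assume sub: "keys f \<subseteq> frob_set q"
  have "Poly_Mapping.single k a \<in> rspan.span (xyz_powers q)" if k: "k \<in> frob_set q" for k and a :: "'a mod_ring"
  proof -
    obtain v where v: "v \<in> {VX, VY, VZ}" "q \<le> expo v k" using k by (auto simp: frob_set_def)
    define k' where "k' = Poly_Mapping.update v (expo v k - q) k"
    have "k = k' + Poly_Mapping.single v q"
      using v(2) by (intro poly_mapping_eqI) (auto simp: k'_def lookup_add lookup_single lookup_update when_def)
    hence "Poly_Mapping.single k a = Poly_Mapping.single k' a * Var v ^ q"
      by (simp add: Var_power mult_single)
    moreover have "Var v ^ q \<in> rspan.span (xyz_powers q :: 'a mod_ring poly4 set)"
      using v(1) by (intro rspan.span_base imageI)
    ultimately show ?thesis by (simp only: rspan.span_scale)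
  qed
  hence "(\<Sum>k\<in>keys f. Poly_Mapping.single k (lookup f k)) \<in> rspan.span (xyz_powers q)"
    using sub by (intro rspan.span_sum) auto
  thus "f \<in> rspan.span (xyz_powers q)" by (simp flip: poly_mapping_eq_sum_single)
qed

lemma in_frob_iff: "in_frob q f \<longleftrightarrow> f \<in> rspan.span (insert fpoly (xyz_powers q))"
proof -
  have "in_frob q f \<longleftrightarrow> (\<exists>t. keys (f - t * fpoly) \<subseteq> frob_set q)"
    unfolding in_frob_def
    by (metis add_diff_cancel_right' diff_add_cancel mult.commute)
  thus ?thesis by (simp only: rspan_insert_iff xyz_powers_span_iff)
qed

lemma constant_plus_span_vars:
  fixes f :: "('p::prime_card mod_ring) poly4"
  obtains a where "f - Poly_Mapping.single 0 a \<in> rspan.span (range Var)"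
proof -
  have "\<exists>a. f - Poly_Mapping.single 0 a \<in> rspan.span (range Var)"
  proof (rule poly4_monomial_decomp[of _ f])
    fix f g :: "'p mod_ring poly4"
    assume "\<exists>a. f - Poly_Mapping.single 0 a \<in> rspan.span (range Var)"
      and "\<exists>a. g - Poly_Mapping.single 0 a \<in> rspan.span (range Var)"
    then obtain a b where "f - Poly_Mapping.single 0 a \<in> rspan.span (range Var)"
      "g - Poly_Mapping.single 0 b \<in> rspan.span (range Var)" by blast
    from rspan.span_add[OF this]
    show "\<exists>a. f + g - Poly_Mapping.single 0 a \<in> rspan.span (range Var)"
      by (intro exI[of _ "a + b"]) (simp add: single_add algebra_simps)
  next
    fix k and a :: "'p mod_ring"
    show "\<exists>b. Poly_Mapping.single k a - Poly_Mapping.single 0 b \<in> rspan.span (range Var)"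
    proof (cases "k = 0")
      case False
      then obtain v where v: "expo v k \<ge> 1"
        by (metis poly_mapping_eqI lookup_zero less_one not_le)
      define k' where "k' = Poly_Mapping.update v (expo v k - 1) k"
      have "k = k' + Poly_Mapping.single v 1"
        using v by (intro poly_mapping_eqI) (auto simp: k'_def lookup_add lookup_single lookup_update when_def)
      hence "Poly_Mapping.single k a = Poly_Mapping.single k' a * Var v"
        by (simp add: Var_def mult_single)
      moreover have "Var v \<in> rspan.span (range Var :: 'p mod_ring poly4 set)"
        by (intro rspan.span_base rangeI)
      ultimately show ?thesis
        by (intro exI[of _ 0]) (simp only: rspan.span_scale single_zero diff_zero)
    next
      case True
      thus ?thesis by (intro exI[of _ a]) (simp add: rspan.span_zero)
    qed
  next
    show "\<exists>a. 0 - Poly_Mapping.single 0 a \<in> rspan.span (range (Var :: var \<Rightarrow> 'p mod_ring poly4))"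
      by (intro exI[of _ 0]) (simp add: rspan.span_zero)
  qed
  thus thesis using that by blast
qed

text \<open>The ideal (X, Y, Z, W^k) of the polynomial ring; its image in R will be identified with
  I + m^k.\<close>

definition xyzw_span :: "nat \<Rightarrow> ('p::prime_card mod_ring) poly4 set" where
  "xyzw_span k = rspan.span (insert (Var VW ^ k) (xyz_powers 1))"

lemma xyzw_span_0: "xyzw_span 0 = UNIV"
proof -
  have "1 \<in> xyzw_span 0" unfolding xyzw_span_def by (rule rspan.span_base) simp
  hence "f * 1 \<in> xyzw_span 0" for f :: "'a mod_ring poly4"
    unfolding xyzw_span_def by (rule rspan.span_scale)
  thus ?thesis by auto
qed

lemma span_range_Var: "rspan.span (range Var) = xyzw_span 1"
proof -
  have "UNIV = {VW, VX, VY, VZ}" by (auto intro: var.exhaust)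
  hence "range Var = Var ` {VW, VX, VY, VZ}" by (simp only:)
  also have "\<dots> = insert (Var VW ^ 1) (xyz_powers 1 :: 'a mod_ring poly4 set)" by simp
  finally show ?thesis unfolding xyzw_span_def by simp
qed

text \<open>If f lies outside the candidate, some W-multiple of f is, up to a unit and modulo the candidate,
  the socle element W^(k-1).\<close>

lemma not_in_xyzw_span:
  fixes f :: "('p::prime_card mod_ring) poly4"
  assumes "f \<notin> xyzw_span k"
  obtains j a where "a \<noteq> 0" "Var VW ^ j * f - Poly_Mapping.single 0 a * Var VW ^ (k - 1) \<in> xyzw_span k"
proof -
  \<comment> \<open>The span for 0 is everything and f is outside the span for k, so f drops out at
    some step in between.\<close>
  have "\<exists>j<k. f \<in> xyzw_span j \<and> f \<notin> xyzw_span (Suc j)"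
    using assms
  proof (induction k)
    case (Suc k) thus ?case by (cases "f \<in> xyzw_span k") (auto simp: less_Suc_eq)
  qed (simp add: xyzw_span_0)
  then obtain j where j: "j < k" "f \<in> xyzw_span j" "f \<notin> xyzw_span (Suc j)" by blast
  obtain r where r: "f - r * Var VW ^ j \<in> rspan.span (xyz_powers 1)"
    using j(2) unfolding xyzw_span_def rspan_insert_iff by blast
  obtain a where "r - Poly_Mapping.single 0 a \<in> rspan.span (range Var)"
    by (rule constant_plus_span_vars)
  then obtain s where s: "r - Poly_Mapping.single 0 a - s * Var VW \<in> rspan.span (xyz_powers 1)"
    unfolding span_range_Var xyzw_span_def rspan_insert_iff power_one_right by blast
  have main: "f - Poly_Mapping.single 0 a * Var VW ^ j - s * Var VW ^ Suc j \<in> rspan.span (xyz_powers 1)"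
    using rspan_diff_substitute[OF r s] by (simp only: power_Suc)
  have "a \<noteq> 0"
  proof
    assume "a = 0"
    hence "f - s * Var VW ^ Suc j \<in> rspan.span (xyz_powers 1)" using main by simp
    hence "f \<in> xyzw_span (Suc j)" unfolding xyzw_span_def rspan_insert_iff by blast
    thus False using j(3) by simp
  qed
  \<comment> \<open>Multiplication by W^l moves W^j to W^(k-1) and the next term to W^k, which the
    span absorbs.\<close>
  moreover define l where "l = k - 1 - j"
  have "Var VW ^ l * f - Poly_Mapping.single 0 a * Var VW ^ (k - 1) - s * Var VW ^ k =
    Var VW ^ l * (f - Poly_Mapping.single 0 a * Var VW ^ j - s * Var VW ^ Suc j)"
  proof -
    have e: "k - 1 = l + j" "k = l + Suc j" using j(1) by (auto simp: l_def)
    show ?thesis unfolding e by (simp add: power_add algebra_simps)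
  qed
  hence "Var VW ^ l * f - Poly_Mapping.single 0 a * Var VW ^ (k - 1) - s * Var VW ^ k \<in> rspan.span (xyz_powers 1)"
    using rspan.span_scale[OF main] by simp
  hence "Var VW ^ l * f - Poly_Mapping.single 0 a * Var VW ^ (k - 1) \<in> xyzw_span k"
    unfolding xyzw_span_def rspan_insert_iff by blast
  ultimately show thesis by (rule that)
qed

section \<open>The quotient ring\<close>

lemma Sring_simps [simp]:
  "carrier Sring = UNIV" "f \<otimes>\<^bsub>Sring\<^esub> g = f * g" "f \<oplus>\<^bsub>Sring\<^esub> g = f + g"
  "\<one>\<^bsub>Sring\<^esub> = 1" "\<zero>\<^bsub>Sring\<^esub> = 0"
  by (simp_all add: Sring_def)

interpretation S: cring Sring
  by (rule cring_Sring)

lemma Sring_a_inv: "\<ominus>\<^bsub>Sring\<^esub> f = - f"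
  by (rule S.minus_equality) simp_all

lemma genideal_fpoly: "genideal Sring {fpoly} = {f. fpoly dvd f}"
proof -
  have "genideal Sring {fpoly} = cgenideal Sring fpoly"
    by (rule S.cgenideal_eq_genideal[symmetric]) simp
  thus ?thesis by (auto simp: cgenideal_def dvd_def mult.commute)
qed

lemma ideal_fpoly: "ideal (genideal Sring {fpoly}) Sring"
  by (rule S.genideal_ideal) simp

definition proj :: "('p::prime_card mod_ring) poly4 \<Rightarrow> 'p mod_ring poly4 set" where
  "proj f = genideal Sring {fpoly} +>\<^bsub>Sring\<^esub> f"

lemma rvar_eq: "rvar v = proj (Var v)"
  by (simp add: rvar_def proj_def)

interpretation R: cring Rring
  unfolding Rring_def by (rule ideal.quotient_is_cring[OF ideal_fpoly cring_Sring])

interpretation proj: ring_hom_cring Sring Rring proj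
proof -
  have "(proj :: 'a mod_ring poly4 \<Rightarrow> _) = (+>\<^bsub>Sring\<^esub>) (genideal Sring {fpoly})"
    by (rule ext) (simp add: proj_def)
  thus "ring_hom_cring Sring Rring (proj :: 'a mod_ring poly4 \<Rightarrow> _)"
    unfolding Rring_def using ideal.rcos_ring_hom_cring[OF ideal_fpoly cring_Sring] by metis
qed

lemma proj_eq_iff: "proj f = proj g \<longleftrightarrow> fpoly dvd f - g"
proof -
  have proj: "proj h = {u. fpoly dvd u - h}" for h :: "'a mod_ring poly4"
    by (auto simp: proj_def a_r_coset_def' genideal_fpoly intro: exI[of _ "_ - h"])
  show ?thesis
  proof
    assume "proj f = proj g"
    moreover have "f \<in> proj f" by (simp add: proj)
    ultimately show "fpoly dvd f - g" by (simp add: proj)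
  next
    assume d: "fpoly dvd f - g"
    have "fpoly dvd u - f \<longleftrightarrow> fpoly dvd u - g" for u
      using dvd_add_left_iff[OF d, of "u - f"] by simp
    thus "proj f = proj g" by (simp add: proj)
  qed
qed

lemma carrier_Rring: "carrier Rring = range proj"
  by (auto simp: Rring_def FactRing_def A_RCOSETS_def' proj_def)

lemma proj_simps:
  "proj f \<otimes>\<^bsub>Rring\<^esub> proj g = proj (f * g)" "proj f \<oplus>\<^bsub>Rring\<^esub> proj g = proj (f + g)"
  "\<zero>\<^bsub>Rring\<^esub> = proj 0" "\<one>\<^bsub>Rring\<^esub> = proj 1"
proof -
  show "proj f \<otimes>\<^bsub>Rring\<^esub> proj g = proj (f * g)" "proj f \<oplus>\<^bsub>Rring\<^esub> proj g = proj (f + g)"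
    using proj.hom_mult[of f g] proj.hom_add[of f g] by simp_all
  show "\<zero>\<^bsub>Rring\<^esub> = proj 0" "\<one>\<^bsub>Rring\<^esub> = proj 1"
    using proj.hom_zero[symmetric] proj.hom_one[symmetric] unfolding Sring_simps .
qed

lemma proj_power: "proj f [^]\<^bsub>Rring\<^esub> (n::nat) = proj (f ^ n)"
  by (induction n) (simp_all add: proj_simps mult.commute)

lemma ideal_proj_span: "ideal (proj ` rspan.span G) Rring"
proof -
  have "ideal (rspan.span G) Sring"
  proof (rule idealI)
    show "subgroup (rspan.span G) (add_monoid Sring)"
      by (rule S.add.subgroupI)
        (auto simp: a_inv_def[symmetric] Sring_a_inv intro: rspan.span_neg rspan.span_add rspan.span_zero)
  next
    show "a \<otimes>\<^bsub>Sring\<^esub> x \<in> rspan.span G" if "a \<in> rspan.span G" for a x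
      using rspan.span_scale[OF that, of x] by (simp add: mult.commute)
  qed (auto simp: S.ring_axioms intro: rspan.span_scale)
  hence "ideal ((+>\<^bsub>Sring\<^esub>) (genideal Sring {fpoly}) ` rspan.span G) Rring"
    unfolding Rring_def by (rule S.ring_ideal_imp_quot_ideal[OF ideal_fpoly])
  thus ?thesis by (simp add: proj_def[abs_def])
qed

lemma proj_span_subset:
  assumes K: "ideal K Rring" and G: "proj ` G \<subseteq> K"
  shows "proj ` rspan.span G \<subseteq> K"
proof -
  interpret K: ideal K Rring by (rule K)
  have "proj f \<in> K" if "f \<in> rspan.span G" for f
    using that
  proof (induction rule: rspan.span_induct_alt)
    case base
    show ?case using K.zero_closed by (simp add: proj_simps)
  next
    case (step c x y)
    have "proj c \<otimes>\<^bsub>Rring\<^esub> proj x \<oplus>\<^bsub>Rring\<^esub> proj y \<in> K"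
      using step G by (intro K.a_closed K.I_l_closed) (auto simp: carrier_Rring)
    thus ?case by (simp add: proj_simps)
  qed
  thus ?thesis by blast
qed

lemma genideal_proj: "genideal Rring (proj ` G) = proj ` rspan.span G"
proof
  show "genideal Rring (proj ` G) \<subseteq> proj ` rspan.span G"
    by (rule R.genideal_minimal[OF ideal_proj_span]) (auto intro: rspan.span_base)
  show "proj ` rspan.span G \<subseteq> genideal Rring (proj ` G)"
    by (intro proj_span_subset R.genideal_ideal R.genideal_self) (auto simp: carrier_Rring)
qed

lemma proj_in_span_iff: "proj f \<in> proj ` rspan.span G \<longleftrightarrow> f \<in> rspan.span (insert fpoly G)"
proof -
  have "proj f \<in> proj ` rspan.span G \<longleftrightarrow> (\<exists>g\<in>rspan.span G. proj f = proj g)"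
    by blast
  also have "\<dots> \<longleftrightarrow> (\<exists>g\<in>rspan.span G. \<exists>k. f - g = fpoly * k)"
    by (simp only: proj_eq_iff dvd_def)
  also have "\<dots> \<longleftrightarrow> (\<exists>g\<in>rspan.span G. \<exists>k. f - k * fpoly = g)"
  proof -
    have "f - g = fpoly * k \<longleftrightarrow> f - k * fpoly = g" for g k
      by (auto simp: algebra_simps)
    thus ?thesis by (simp only:)
  qed
  also have "\<dots> \<longleftrightarrow> (\<exists>k. f - k * fpoly \<in> rspan.span G)"
    by blast
  finally show ?thesis by (simp add: rspan_insert_iff)
qed

lemma proj_in_frobenius_power_iff:
  fixes f :: "('p::prime_card mod_ring) poly4"
  shows "proj f \<in> frobenius_power Rring {rvar VX, rvar VY, rvar VZ} q \<longleftrightarrow> in_frob q f"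
proof -
  have "(\<lambda>g. g [^]\<^bsub>Rring\<^esub> q) ` {rvar VX, rvar VY, rvar VZ} =
      proj ` (xyz_powers q :: 'p mod_ring poly4 set)"
    by (simp add: rvar_eq proj_power)
  hence "frobenius_power Rring {rvar VX, rvar VY, rvar VZ} q =
      proj ` rspan.span (xyz_powers q :: 'p mod_ring poly4 set)"
    unfolding frobenius_power_def using genideal_proj[of "xyz_powers q"] by metis
  thus ?thesis unfolding in_frob_iff proj_in_span_iff[symmetric] by simp
qed

lemma Rring_nontrivial: "\<one>\<^bsub>Rring\<^esub> \<noteq> \<zero>\<^bsub>Rring :: ('p::prime_card mod_ring) poly4 set ring\<^esub>"
proof
  assume "\<one>\<^bsub>Rring\<^esub> = \<zero>\<^bsub>Rring :: ('p::prime_card mod_ring) poly4 set ring\<^esub>"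
  then obtain t :: "'p mod_ring poly4" where t: "1 = 0 + fpoly * t"
    by (auto simp: proj_simps proj_eq_iff dvd_def)
  have "keys (1 :: 'p mod_ring poly4) \<subseteq> {}"
    by (rule W_reduced_mem[OF _ _ _ t]) (auto simp: up_closed_def w_free_def deg_le_one)
  thus False by simp
qed

text \<open>Zero lies in every ideal and R, being nontrivial, has a minimal prime; so an element
  outside all minimal primes is nonzero.\<close>

lemma not_in_minimal_primes_imp:
  fixes c :: "('p::prime_card mod_ring) poly4"
  assumes "\<And>P. minimal_prime Rring P \<Longrightarrow> proj c \<notin> P"
  shows "\<not> fpoly dvd c"
proof
  assume "fpoly dvd c"
  hence "proj c = \<zero>\<^bsub>Rring\<^esub>" by (simp add: proj_simps proj_eq_iff)
  moreover obtain P where P: "minimal_prime (Rring :: 'p mod_ring poly4 set ring) P"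
    using R.exists_minimal_prime[OF Rring_nontrivial] by blast
  hence "ideal P (Rring :: 'p mod_ring poly4 set ring)"
    by (auto simp: minimal_prime_def primeideal_def)
  hence "\<zero>\<^bsub>Rring\<^esub> \<in> P" by (simp add: additive_subgroup.zero_closed ideal_def)
  ultimately show False using assms[OF P] by simp
qed

lemma X_not_in_minimal_primes:
  fixes P :: "('p::prime_card mod_ring) poly4 set set"
  assumes "minimal_prime Rring P"
  shows "proj (Var VX) \<notin> P"
proof (rule R.nonzerodivisor_not_in_minimal_prime[OF _ _ assms])
  show "proj (Var VX) \<in> carrier Rring" by (simp add: carrier_Rring)
next
  fix s :: "'p mod_ring poly4 set"
  assume "s \<in> carrier Rring" and s: "proj (Var VX) \<otimes>\<^bsub>Rring\<^esub> s = \<zero>\<^bsub>Rring\<^esub>"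
  then obtain t where t: "s = proj t" by (auto simp: carrier_Rring)
  have "fpoly dvd Var VX * t" using s by (simp add: t proj_simps proj_eq_iff)
  hence "fpoly dvd t" by (rule fpoly_dvd_X_mult)
  thus "s = \<zero>\<^bsub>Rring\<^esub>" by (simp add: t proj_simps proj_eq_iff)
qed

section \<open>The tight closure of I\<close>

text \<open>f^q is a combination of X^q, Y^q, Z^q and W^(kq), and multiplication by X brings the
  last generator into the lifted Frobenius power as well.\<close>

lemma xyzw_span_frobenius:
  fixes f :: "('p::prime_card mod_ring) poly4"
  assumes pk: "closure_order CARD('p) k" and "f \<in> xyzw_span k" and "e \<ge> 2"
  shows "in_frob (CARD('p) ^ e) (Var VX * f ^ (CARD('p) ^ e))"
proof -
  let ?q = "CARD('p) ^ e"
  have "f ^ (CHAR('p mod_ring poly4) ^ e) \<in>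
      rspan.span ((\<lambda>g. g ^ (CHAR('p mod_ring poly4) ^ e)) ` insert (Var VW ^ k) (xyz_powers 1))"
    by (rule rspan_power) (use assms(2) in \<open>simp_all add: xyzw_span_def CHAR_poly4 semiring_char_mod_ring prime_card\<close>)
  hence "f ^ ?q \<in> rspan.span (insert (Var VW ^ (k * ?q)) (xyz_powers ?q))"
    by (simp add: CHAR_poly4 semiring_char_mod_ring power_mult)
  then obtain t where t: "f ^ ?q - t * Var VW ^ (k * ?q) \<in> rspan.span (xyz_powers ?q)"
    unfolding rspan_insert_iff by blast
  hence "f ^ ?q - t * Var VW ^ (k * ?q) \<in> rspan.span (insert fpoly (xyz_powers ?q))"
    using rspan.span_mono[of "xyz_powers ?q" "insert fpoly (xyz_powers ?q)"] by blast
  hence "Var VX * (f ^ ?q - t * Var VW ^ (k * ?q)) + t * (Var VX * Var VW ^ (k * ?q)) \<in>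
      rspan.span (insert fpoly (xyz_powers ?q))"
    using X_W_in_frob[OF pk assms(3)] unfolding in_frob_iff
    by (intro rspan.span_add[OF rspan.span_scale rspan.span_scale])
  thus ?thesis by (simp add: in_frob_iff algebra_simps)
qed

text \<open>One inclusion uses the multiplier X. For the other, an f outside the span leads to
  W^(k-1) itself, with multiplier Xc; then \<open>fpoly\<close> divides Xc, hence c, contrary to the
  choice of c.\<close>

lemma in_tight_closure_iff:
  fixes f :: "('p::prime_card mod_ring) poly4"
  assumes pk: "closure_order CARD('p) k"
  shows "proj f \<in> tight_closure Rring CARD('p) {rvar VX, rvar VY, rvar VZ} \<longleftrightarrow> f \<in> xyzw_span k"
proof
  assume f: "f \<in> xyzw_span k"
  have "proj (Var VX) \<otimes>\<^bsub>Rring\<^esub> proj f [^]\<^bsub>Rring\<^esub> (CARD('p) ^ e) \<in>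
      frobenius_power Rring {rvar VX, rvar VY, rvar VZ} (CARD('p) ^ e)" if "e \<ge> 2" for e
    using xyzw_span_frobenius[OF pk f that]
    by (simp add: proj_power proj_simps proj_in_frobenius_power_iff)
  thus "proj f \<in> tight_closure Rring CARD('p) {rvar VX, rvar VY, rvar VZ}"
    unfolding tight_closure_def using X_not_in_minimal_primes
    by (auto simp: carrier_Rring)
next
  assume "proj f \<in> tight_closure Rring CARD('p) {rvar VX, rvar VY, rvar VZ}"
  then obtain c e0 where c: "\<And>P. minimal_prime Rring P \<Longrightarrow> proj c \<notin> P"
    and mem: "\<And>e. e \<ge> e0 \<Longrightarrow> in_frob (CARD('p) ^ e) (c * f ^ (CARD('p) ^ e))"
    unfolding tight_closure_def
    by (auto simp: carrier_Rring proj_power proj_simps proj_in_frobenius_power_iff)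
  show "f \<in> xyzw_span k"
  proof (rule ccontr)
    assume "f \<notin> xyzw_span k"
    then obtain j a where a: "a \<noteq> 0"
      and u: "Var VW ^ j * f - Poly_Mapping.single 0 a * Var VW ^ (k - 1) \<in> xyzw_span k"
      by (rule not_in_xyzw_span)
    define u where "u = Var VW ^ j * f - Poly_Mapping.single 0 a * Var VW ^ (k - 1)"
    have "in_frob (CARD('p) ^ e) (Var VX * c * Var VW ^ ((k - 1) * CARD('p) ^ e))"
      if e: "e \<ge> max e0 2" for e
    proof -
      let ?q = "CARD('p) ^ e" and ?a = "Poly_Mapping.single 0 a :: 'p mod_ring poly4"
      have "(Var VW ^ j * f) ^ ?q = (u + ?a * Var VW ^ (k - 1)) ^ ?q" by (simp add: u_def)
      also have "\<dots> = u ^ ?q + ?a ^ ?q * Var VW ^ ((k - 1) * ?q)"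
        by (simp add: frobenius_add power_mult_distrib power_mult)
      finally have *: "?a ^ ?q * Var VW ^ ((k - 1) * ?q) = (Var VW ^ j) ^ ?q * f ^ ?q - u ^ ?q"
        by (simp add: power_mult_distrib)
      have "in_frob ?q (Var VX * u ^ ?q)"
        using xyzw_span_frobenius[OF pk] u e by (simp add: u_def)
      moreover have "in_frob ?q (c * f ^ ?q)" using mem e by simp
      \<comment> \<open>The first term is a member by the choice of c, the second because u lies in
        the span; their difference isolates the power of W.\<close>
      ultimately have "(Var VX * (Var VW ^ j) ^ ?q) * (c * f ^ ?q) - c * (Var VX * u ^ ?q) \<in>
          rspan.span (insert fpoly (xyz_powers ?q))"
        unfolding in_frob_iff by (intro rspan.span_diff[OF rspan.span_scale rspan.span_scale])
      also have "(Var VX * (Var VW ^ j) ^ ?q) * (c * f ^ ?q) - c * (Var VX * u ^ ?q) =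
          Var VX * c * (?a ^ ?q * Var VW ^ ((k - 1) * ?q))"
        unfolding * by (simp add: algebra_simps)
      \<comment> \<open>The nonzero scalar a^q is cancelled by the q-th power of the inverse of
        a.\<close>
      finally have "in_frob ?q (Var VX * c * (?a ^ ?q * Var VW ^ ((k - 1) * ?q)) *
          Poly_Mapping.single 0 (inverse a) ^ ?q)"
        unfolding in_frob_iff[symmetric] by (rule in_frob_mult)
      also have "Var VX * c * (?a ^ ?q * Var VW ^ ((k - 1) * ?q)) * Poly_Mapping.single 0 (inverse a) ^ ?q =
          Var VX * c * Var VW ^ ((k - 1) * ?q) * (?a * Poly_Mapping.single 0 (inverse a)) ^ ?q"
        by (simp only: power_mult_distrib mult_ac)
      also have "?a * Poly_Mapping.single 0 (inverse a) = 1"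
        using a by (simp add: mult_single)
      finally show ?thesis by simp
    qed
    hence "fpoly dvd Var VX * c" by (rule not_in_frob[OF pk])
    thus False using fpoly_dvd_X_mult not_in_minimal_primes_imp[OF c] by blast
  qed
qed

lemma tight_closure_eq:
  assumes pk: "closure_order CARD('p) k"
  shows "tight_closure (Rring :: ('p::prime_card mod_ring) poly4 set ring) CARD('p) {rvar VX, rvar VY, rvar VZ} =
    proj ` xyzw_span k"
proof -
  have "tight_closure (Rring :: 'p mod_ring poly4 set ring) CARD('p) {rvar VX, rvar VY, rvar VZ} \<subseteq> range proj"
    by (auto simp: tight_closure_def carrier_Rring)
  thus ?thesis using in_tight_closure_iff[OF pk] by blast
qed

section \<open>Powers of the maximal ideal\<close>

lemma ideal_power_ideal:
  assumes "ideal m Rring"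
  shows "ideal (ideal_power Rring m k) Rring"
  by (induction k) (auto simp: R.oneideal intro: R.ideal_prod_is_ideal assms)

lemma ideal_power_W:
  assumes "rvar VW \<in> m"
  shows "proj (Var VW ^ k) \<in> ideal_power Rring m k"
proof (induction k)
  case (Suc k)
  have "rvar VW \<otimes>\<^bsub>Rring\<^esub> proj (Var VW ^ k) \<in> ideal_prod Rring m (ideal_power Rring m k)"
    using assms Suc by (rule ideal_prod.prod)
  thus ?case by (simp add: rvar_eq proj_simps)
qed (simp add: carrier_Rring)

text \<open>Modulo X, Y, Z the factors are multiples of W and of W^k, so their product is a multiple
  of W^(k+1).\<close>

lemma ideal_power_subset: "ideal_power Rring (proj ` xyzw_span 1) k \<subseteq> proj ` xyzw_span k"
proof (induction k)
  case 0
  show ?case by (simp add: carrier_Rring xyzw_span_0)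
next
  case (Suc k)
  have mult: "f * g \<in> xyzw_span (Suc k)" if f: "f \<in> xyzw_span 1" and g: "g \<in> xyzw_span k"
    for f g :: "'a mod_ring poly4"
  proof -
    let ?I = "rspan.span (xyz_powers 1) :: 'a mod_ring poly4 set"
    obtain s t where s: "f - s * Var VW \<in> ?I" and t: "g - t * Var VW ^ k \<in> ?I"
      using f g unfolding xyzw_span_def rspan_insert_iff power_one_right by blast
    have "g * (f - s * Var VW) + (s * Var VW) * (g - t * Var VW ^ k) \<in> ?I"
      by (intro rspan.span_add[OF rspan.span_scale rspan.span_scale] s t)
    hence "f * g - (s * t) * Var VW ^ Suc k \<in> ?I" by (simp add: algebra_simps)
    thus ?thesis unfolding xyzw_span_def rspan_insert_iff by blast
  qed
  show ?case
  proof
    fix x :: "'a mod_ring poly4 set"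
    assume "x \<in> ideal_power Rring (proj ` xyzw_span 1) (Suc k)"
    hence "x \<in> ideal_prod Rring (proj ` xyzw_span 1) (ideal_power Rring (proj ` xyzw_span 1) k)"
      by simp
    thus "x \<in> proj ` xyzw_span (Suc k)"
    proof (induction rule: ideal_prod.induct)
      case (prod i j)
      thus ?case using Suc mult by (auto simp: proj_simps)
    next
      case (sum i j)
      thus ?case by (auto simp: proj_simps xyzw_span_def rspan.span_add)
    qed
  qed
qed

text \<open>The left side is an ideal containing x, y, z and w^k, the generators of the right side;
  conversely the right side contains both summands.\<close>

lemma I_plus_power_eq:
  assumes I: "I = genideal Rring {rvar VX, rvar VY, rvar VZ}"
    and m: "m = proj ` xyzw_span 1"
  shows "I <+>\<^bsub>Rring\<^esub> ideal_power Rring m k = proj ` xyzw_span k"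
proof
  have I': "I = proj ` rspan.span (xyz_powers 1)"
    unfolding I genideal_proj[symmetric] by (simp add: rvar_eq)
  have ideals: "ideal I Rring" "ideal (ideal_power Rring m k) Rring"
    unfolding I' m xyzw_span_def by (intro ideal_proj_span ideal_power_ideal)+
  interpret I: ideal I Rring by (rule ideals(1))
  interpret mk: ideal "ideal_power Rring m k" Rring by (rule ideals(2))
  interpret span: ideal "proj ` xyzw_span k" Rring
    unfolding xyzw_span_def by (rule ideal_proj_span)
  have "I \<subseteq> proj ` xyzw_span k"
    unfolding I' xyzw_span_def by (intro image_mono rspan.span_mono) auto
  thus "I <+>\<^bsub>Rring\<^esub> ideal_power Rring m k \<subseteq> proj ` xyzw_span k"
    using ideal_power_subset[of k] unfolding set_add_def' m by (auto intro!: span.a_closed)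
  have left: "I \<subseteq> I <+>\<^bsub>Rring\<^esub> ideal_power Rring m k"
  proof
    fix x assume x: "x \<in> I"
    hence "x \<oplus>\<^bsub>Rring\<^esub> \<zero>\<^bsub>Rring\<^esub> \<in> I <+>\<^bsub>Rring\<^esub> ideal_power Rring m k"
      using mk.zero_closed unfolding set_add_def' by blast
    thus "x \<in> I <+>\<^bsub>Rring\<^esub> ideal_power Rring m k"
      by (simp only: R.r_zero[OF I.Icarr[OF x]])
  qed
  have right: "ideal_power Rring m k \<subseteq> I <+>\<^bsub>Rring\<^esub> ideal_power Rring m k"
  proof
    fix x assume x: "x \<in> ideal_power Rring m k"
    hence "\<zero>\<^bsub>Rring\<^esub> \<oplus>\<^bsub>Rring\<^esub> x \<in> I <+>\<^bsub>Rring\<^esub> ideal_power Rring m k"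
      using I.zero_closed unfolding set_add_def' by blast
    thus "x \<in> I <+>\<^bsub>Rring\<^esub> ideal_power Rring m k"
      by (simp only: R.l_zero[OF mk.Icarr[OF x]])
  qed
  have "rvar VW \<in> m"
    unfolding m rvar_eq xyzw_span_def by (intro imageI rspan.span_base) simp
  hence "proj (Var VW ^ k) \<in> I <+>\<^bsub>Rring\<^esub> ideal_power Rring m k"
    using ideal_power_W right by blast
  moreover have "proj ` xyz_powers 1 \<subseteq> I <+>\<^bsub>Rring\<^esub> ideal_power Rring m k"
    using left unfolding I' by (auto intro: rspan.span_base)
  ultimately show "proj ` xyzw_span k \<subseteq> I <+>\<^bsub>Rring\<^esub> ideal_power Rring m k"
    unfolding xyzw_span_def by (intro proj_span_subset R.add_ideals ideals) auto
qed

theorem theorem6p1: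
  fixes p :: nat and I m :: "('p::prime_card mod_ring) poly4 set set"
  assumes "p = CARD('p)"
    and "I = genideal Rring {rvar VX, rvar VY, rvar VZ}"
    and "m = genideal Rring {rvar VX, rvar VY, rvar VZ, rvar VW}"
  shows "(p = 2 \<longrightarrow> tight_closure Rring p {rvar VX, rvar VY, rvar VZ} = m)
       \<and> (p = 3 \<longrightarrow> tight_closure Rring p {rvar VX, rvar VY, rvar VZ} = I <+>\<^bsub>Rring\<^esub> ideal_power Rring m 2)
       \<and> (p \<ge> 5 \<longrightarrow> tight_closure Rring p {rvar VX, rvar VY, rvar VZ} = I <+>\<^bsub>Rring\<^esub> ideal_power Rring m 3)"
proof -
  have "{rvar VX, rvar VY, rvar VZ, rvar VW} =
      proj ` insert (Var VW ^ 1) (xyz_powers 1 :: 'p mod_ring poly4 set)"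
    by (auto simp: rvar_eq)
  hence m: "m = proj ` xyzw_span 1"
    unfolding assms(3) xyzw_span_def by (simp only: genideal_proj)
  have tc: "tight_closure Rring p {rvar VX, rvar VY, rvar VZ} = (proj ` xyzw_span k :: 'p mod_ring poly4 set set)"
    if "closure_order p k" for k
    using tight_closure_eq that unfolding assms(1) by blast
  show ?thesis
    \<comment> \<open>For k = 1 the span already has image m, which gives the case p = 2
      directly.\<close>
    using tc[of 1] tc[of 2] tc[of 3] m I_plus_power_eq[OF assms(2) m]
    by (simp add: closure_order_def)
qed

end
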